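(* Let $M$ and $N$ be oriented connected differentiable ($C^1$) manifolds of dimension $n\geq 1$ and let $f:M\to N$ be a differentiable (not necessarily $C^1$) map. Suppose that there exist $x_0$ and $x_1$ in $M$ such that $\det[f'(x_0)]<0$ and $\det[f'(x_1)]>0$. Then $f$ has a critical point.
   Context: A map between differentiable manifolds is differentiable if it is differentiable at every point when read in charts. For $x\in M$, $\det[f'(x)]$ denotes the determinant of the derivative of $f$ at $x$ computed in orientation-compatible (positively oriented) charts around $x$ and $f(x)$; its sign, and whether it vanishes, do not depend on the choice of such charts. A critical point of $f$ is a point $x\in M$ at which $f'(x)$ is not invertible, i.e. $\det[f'(x)]=0$. *)

theory Defs
  imports "HOL-Analysis.Analysis"
begin

(* A chart is a pair of its domain and its coordinate map; the values of the
   coordinate map outside the domain are irrelevant.  Manifolds are modelled on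
   real ^ 'n, so the dimension is CARD('n), which is at least 1. *)
type_synonym ('a, 'n) chart = "'a set \<times> ('a \<Rightarrow> real ^ 'n)"

definition local_chart :: "'a topology \<Rightarrow> ('a, 'n::finite) chart \<Rightarrow> bool" where
  "local_chart X c \<longleftrightarrow> openin X (fst c) \<and> open (snd c ` fst c) \<and>
     homeomorphic_map (subtopology X (fst c)) (top_of_set (snd c ` fst c)) (snd c)"

definition chart_inv :: "('a, 'n::finite) chart \<Rightarrow> real ^ 'n \<Rightarrow> 'a" where
  "chart_inv c = inv_into (fst c) (snd c)"

(* f read in the charts c and d.  Near the coordinates of x this is meaningful
   when f is continuous at x and x, f x lie in the domains of c and d. *)
definition chart_rep ::
  "('a \<Rightarrow> 'b) \<Rightarrow> ('a, 'n::finite) chart \<Rightarrow> ('b, 'n) chart \<Rightarrow> real ^ 'n \<Rightarrow> real ^ 'n" where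
  "chart_rep f c d = snd d \<circ> f \<circ> chart_inv c"

definition chart_det ::
  "('a \<Rightarrow> 'b) \<Rightarrow> ('a, 'n::finite) chart \<Rightarrow> ('b, 'n) chart \<Rightarrow> 'a \<Rightarrow> real" where
  "chart_det f c d x = det (jacobian (chart_rep f c d) (at (snd c x)))"

definition C1_on :: "(real ^ 'n::finite) set \<Rightarrow> (real ^ 'n \<Rightarrow> real ^ 'n) \<Rightarrow> bool" where
  "C1_on S g \<longleftrightarrow> (\<forall>u\<in>S. g differentiable (at u)) \<and> continuous_on S (\<lambda>u. jacobian g (at u))"

(* chart_rep id c d is the change of coordinates from c to d. *)
definition C1_compatible :: "('a, 'n::finite) chart \<Rightarrow> ('a, 'n) chart \<Rightarrow> bool" where
  "C1_compatible c d \<longleftrightarrow>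
     C1_on (snd c ` (fst c \<inter> fst d)) (chart_rep id c d) \<and>
     C1_on (snd d ` (fst c \<inter> fst d)) (chart_rep id d c)"

definition same_orientation :: "('a, 'n::finite) chart \<Rightarrow> ('a, 'n) chart \<Rightarrow> bool" where
  "same_orientation c d \<longleftrightarrow>
     (\<forall>x \<in> fst c \<inter> fst d. 0 < chart_det id c d x \<and> 0 < chart_det id d c x)"

definition C1_manifold :: "'a topology \<Rightarrow> ('a, 'n::finite) chart set \<Rightarrow> bool" where
  "C1_manifold X A \<longleftrightarrow> Hausdorff_space X \<and> second_countable X \<and>
     (\<forall>c\<in>A. local_chart X c) \<and> (\<Union>c\<in>A. fst c) = topspace X \<and>
     (\<forall>c\<in>A. \<forall>d\<in>A. C1_compatible c d)"

(* The orientation is the one represented by the given atlas. *)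
definition oriented_C1_manifold :: "'a topology \<Rightarrow> ('a, 'n::finite) chart set \<Rightarrow> bool" where
  "oriented_C1_manifold X A \<longleftrightarrow> C1_manifold X A \<and> (\<forall>c\<in>A. \<forall>d\<in>A. same_orientation c d)"

(* The positively oriented charts around x: those of the maximal oriented
   C1 atlas generated by A, not only the members of A. *)
definition positive_charts_at ::
  "'a topology \<Rightarrow> ('a, 'n::finite) chart set \<Rightarrow> 'a \<Rightarrow> ('a, 'n) chart set" where
  "positive_charts_at X A x = {c. local_chart X c \<and> x \<in> fst c \<and>
     (\<forall>d\<in>A. C1_compatible c d \<and> same_orientation c d)}"

definition manifold_differentiable_at ::
  "'a topology \<Rightarrow> ('a, 'n::finite) chart set \<Rightarrow> 'b topology \<Rightarrow> ('b, 'n) chart set \<Rightarrow>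
   ('a \<Rightarrow> 'b) \<Rightarrow> 'a \<Rightarrow> bool" where
  "manifold_differentiable_at X A Y B f x \<longleftrightarrow> topcontinuous_at X Y f x \<and>
     (\<exists>c \<in> positive_charts_at X A x. \<exists>d \<in> positive_charts_at Y B (f x).
        chart_rep f c d differentiable (at (snd c x)))"

definition manifold_differentiable ::
  "'a topology \<Rightarrow> ('a, 'n::finite) chart set \<Rightarrow> 'b topology \<Rightarrow> ('b, 'n) chart set \<Rightarrow>
   ('a \<Rightarrow> 'b) \<Rightarrow> bool" where
  "manifold_differentiable X A Y B f \<longleftrightarrow>
     (\<forall>x \<in> topspace X. manifold_differentiable_at X A Y B f x)"

(* By sgn_chart_det_independent below, quantifying over all or over some
   positively oriented charts makes no difference for differentiable f. *)
definition critical_point ::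
  "'a topology \<Rightarrow> ('a, 'n::finite) chart set \<Rightarrow> 'b topology \<Rightarrow> ('b, 'n) chart set \<Rightarrow>
   ('a \<Rightarrow> 'b) \<Rightarrow> 'a \<Rightarrow> bool" where
  "critical_point X A Y B f x \<longleftrightarrow> x \<in> topspace X \<and>
     (\<forall>c \<in> positive_charts_at X A x. \<forall>d \<in> positive_charts_at Y B (f x). chart_det f c d x = 0)"

lemma positive_charts_at_nonempty:
  assumes "oriented_C1_manifold X A" "x \<in> topspace X"
  shows "\<exists>c\<in>A. c \<in> positive_charts_at X A x"
  using assms unfolding oriented_C1_manifold_def C1_manifold_def positive_charts_at_def
  by blast

lemma local_chart_inj: "local_chart X c \<Longrightarrow> inj_on (snd c) (fst c)"
  unfolding local_chart_def homeomorphic_map_def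
  using openin_subset[of X "fst c"] by (simp add: Int_absorb1)

lemma chart_inv_app: "local_chart X c \<Longrightarrow> y \<in> fst c \<Longrightarrow> chart_inv c (snd c y) = y"
  unfolding chart_inv_def by (simp add: local_chart_inj)

lemma open_chart_image:
  assumes "local_chart X c" "openin X U"
  shows "open (snd c ` (fst c \<inter> U))"
proof -
  have "openin (subtopology X (fst c)) (fst c \<inter> U)"
    using assms(2) by (simp add: openin_subtopology_Int2)
  then have "openin (top_of_set (snd c ` fst c)) (snd c ` (fst c \<inter> U))"
    using assms(1) homeomorphic_imp_open_map[of "subtopology X (fst c)" _ "snd c"]
    unfolding local_chart_def open_map_def by blast
  then show ?thesis
    using assms(1) openin_open_trans unfolding local_chart_def by blast
qed

lemma chart_change:
  fixes c c' :: "('a, 'n::finite) chart" and d d' :: "('b, 'n) chart"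
  assumes c: "local_chart X c" "x \<in> fst c" and c': "local_chart X c'" "x \<in> fst c'"
    and d: "local_chart Y d" "f x \<in> fst d" and d': "local_chart Y d'" "f x \<in> fst d'"
    and cont: "topcontinuous_at X Y f x"
    and diff: "chart_rep f c d differentiable (at (snd c x))"
    and t1: "chart_rep id c' c differentiable (at (snd c' x))"
    and t2: "chart_rep id d d' differentiable (at (snd d (f x)))"
  shows "chart_rep f c' d' differentiable (at (snd c' x))"
    and "chart_det f c' d' x = chart_det id d d' (f x) * chart_det f c d x * chart_det id c' c x"
proof -
  let ?g = "chart_rep id d d' \<circ> chart_rep f c d \<circ> chart_rep id c' c"
  let ?J = "jacobian (chart_rep id d d') (at (snd d (f x))) **
            jacobian (chart_rep f c d) (at (snd c x)) **
            jacobian (chart_rep id c' c) (at (snd c' x))"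
  have e1: "chart_rep id c' c (snd c' x) = snd c x"
    using c' by (simp add: chart_rep_def chart_inv_app)
  have e2: "chart_rep f c d (snd c x) = snd d (f x)"
    using c by (simp add: chart_rep_def chart_inv_app)
  have "((chart_rep f c d \<circ> chart_rep id c' c) has_derivative
        ((\<lambda>h. jacobian (chart_rep f c d) (at (snd c x)) *v h) \<circ>
         (\<lambda>h. jacobian (chart_rep id c' c) (at (snd c' x)) *v h))) (at (snd c' x))"
    by (rule diff_chain_at) (use diff t1 e1 in \<open>simp_all add: jacobian_works\<close>)
  then have "(chart_rep id d d' \<circ> (chart_rep f c d \<circ> chart_rep id c' c) has_derivative
        ((\<lambda>h. jacobian (chart_rep id d d') (at (snd d (f x))) *v h) \<circ>
        ((\<lambda>h. jacobian (chart_rep f c d) (at (snd c x)) *v h) \<circ>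
         (\<lambda>h. jacobian (chart_rep id c' c) (at (snd c' x)) *v h)))) (at (snd c' x))"
    by (rule diff_chain_at) (use t2 e1 e2 in \<open>simp_all add: jacobian_works\<close>)
  then have "(?g has_derivative (\<lambda>h. ?J *v h)) (at (snd c' x))"
    by (simp add: o_def matrix_vector_mul_assoc matrix_mul_assoc)
  note g = this
  obtain U where U: "openin X U" "x \<in> U" "\<And>y. y \<in> U \<Longrightarrow> f y \<in> fst d \<inter> fst d'"
  proof -
    have "openin Y (fst d \<inter> fst d')" "f x \<in> fst d \<inter> fst d'"
      using d d' by (auto simp: local_chart_def)
    then show thesis
      using cont that unfolding topcontinuous_at_def by (elim conjE) metis
  qed
  have "openin X (fst c \<inter> U)"
    using U c by (auto simp: local_chart_def)
  then have S: "open (snd c' ` (fst c' \<inter> (fst c \<inter> U)))"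
    by (rule open_chart_image[OF c'(1)])
  have xS: "snd c' x \<in> snd c' ` (fst c' \<inter> (fst c \<inter> U))"
    using c c' U by blast
  have eq: "?g u = chart_rep f c' d' u" if "u \<in> snd c' ` (fst c' \<inter> (fst c \<inter> U))" for u
  proof -
    obtain y where y: "u = snd c' y" "y \<in> fst c'" "y \<in> fst c" "y \<in> U"
      using \<open>u \<in> _\<close> by blast
    then show ?thesis
      using U(3)[of y] c(1) c'(1) d(1) by (simp add: chart_rep_def chart_inv_app)
  qed
  have *: "(chart_rep f c' d' has_derivative (\<lambda>h. ?J *v h)) (at (snd c' x))"
    by (rule has_derivative_transform_within_open[OF g S xS eq])
  then show "chart_rep f c' d' differentiable (at (snd c' x))"
    by (auto simp: differentiable_def)
  have "jacobian (chart_rep f c' d') (at (snd c' x)) = ?J"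
    by (simp add: jacobian_def frechet_derivative_at[OF *, symmetric] matrix_of_matrix_vector_mul)
  then show "chart_det f c' d' x = chart_det id d d' (f x) * chart_det f c d x * chart_det id c' c x"
    by (simp add: chart_det_def det_mul)
qed

lemma C1_compatible_differentiable:
  assumes "C1_compatible c d" "x \<in> fst c" "x \<in> fst d"
  shows "chart_rep id c d differentiable (at (snd c x))"
    and "chart_rep id d c differentiable (at (snd d x))"
  using assms unfolding C1_compatible_def C1_on_def by blast+

lemma sgn_chart_det_independent:
  assumes M: "oriented_C1_manifold X A" and N: "oriented_C1_manifold Y B"
    and cont: "topcontinuous_at X Y f x"
    and c: "c \<in> positive_charts_at X A x" and c': "c' \<in> positive_charts_at X A x"
    and d: "d \<in> positive_charts_at Y B (f x)" and d': "d' \<in> positive_charts_at Y B (f x)"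
    and diff: "chart_rep f c d differentiable (at (snd c x))"
  shows "chart_rep f c' d' differentiable (at (snd c' x))"
    and "sgn (chart_det f c' d' x) = sgn (chart_det f c d x)"
proof -
  have xX: "x \<in> topspace X" "f x \<in> topspace Y"
    using cont by (auto simp: topcontinuous_at_def)
  obtain a b where ab: "a \<in> A" "a \<in> positive_charts_at X A x"
      "b \<in> B" "b \<in> positive_charts_at Y B (f x)"
    using positive_charts_at_nonempty[OF M xX(1)] positive_charts_at_nonempty[OF N xX(2)] by blast
  note P = c c' d d' ab
  have P': "local_chart X c" "local_chart X c'" "local_chart X a"
     "x \<in> fst c" "x \<in> fst c'" "x \<in> fst a" "C1_compatible c a" "C1_compatible c' a"
     "same_orientation c a" "same_orientation c' a"
     "local_chart Y d" "local_chart Y d'" "local_chart Y b"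
     "f x \<in> fst d" "f x \<in> fst d'" "f x \<in> fst b" "C1_compatible d b" "C1_compatible d' b"
     "same_orientation d b" "same_orientation d' b"
    using P unfolding positive_charts_at_def by auto
  have pos: "0 < chart_det id a c x" "0 < chart_det id c' a x"
      "0 < chart_det id d b (f x)" "0 < chart_det id b d' (f x)"
    using P' unfolding same_orientation_def by blast+
  have T: "chart_rep id a c differentiable (at (snd a x))"
       "chart_rep id c' a differentiable (at (snd c' x))"
       "chart_rep id d b differentiable (at (snd d (f x)))"
       "chart_rep id b d' differentiable (at (snd b (f x)))"
    by (rule C1_compatible_differentiable(2)[of c a x] C1_compatible_differentiable(1)[of c' a x]
          C1_compatible_differentiable(1)[of d b "f x"] C1_compatible_differentiable(2)[of d' b "f x"];
        fact P')+
  have 1: "chart_rep f a b differentiable (at (snd a x))"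
    "chart_det f a b x = chart_det id d b (f x) * chart_det f c d x * chart_det id a c x"
    using chart_change[of X c x a Y d f b] P' T cont diff by simp_all
  have 2: "chart_rep f c' d' differentiable (at (snd c' x))"
    "chart_det f c' d' x = chart_det id b d' (f x) * chart_det f a b x * chart_det id c' a x"
    using chart_change[of X a x c' Y b f d'] P' T cont 1(1) by simp_all
  show "chart_rep f c' d' differentiable (at (snd c' x))" by fact
  show "sgn (chart_det f c' d' x) = sgn (chart_det f c d x)"
    using pos 1(2) 2(2) by (simp add: sgn_mult)
qed

end

theory Submission
  imports Defs "HOL-Homology.Homology"
begin

text \<open>
  In charts, a differentiable map without critical points is locally injective, although it need not
  be \<open>C\<^sup>1\<close> (Saint Raymond; the argument below follows Tao). Let \<open>E\<close> be the set of points where local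
  injectivity fails. By Baire, near some point of \<open>E\<close> there is \<open>c > 0\<close> with
  \<open>\<bar>f y - f x\<bar> \<ge> c \<bar>y - x\<bar>\<close> for all \<open>x \<in> E\<close> and all \<open>y\<close>. For \<open>w \<notin> E\<close> let \<open>x\<close> be the nearest point
  of \<open>E\<close>; on the ball around \<open>w\<close> that touches \<open>x\<close>, \<open>f\<close> is a local homeomorphism, and close to \<open>x\<close> it is
  nearly affine, so by lifting through coverings some point \<open>u\<close> there is the only preimage of \<open>f u\<close>.
  Being the only preimage is an open and closed condition on that ball, so it also holds for \<open>w\<close>.
  Hence \<open>f\<close> is injective near a point of \<open>E\<close>, a contradiction.

  For an injective \<open>f\<close> on a ball, the maps \<open>u \<mapsto> f (x + s u) - f x\<close> of the unit sphere into the
  complement of the origin are homotopic for different \<open>x\<close>, and for small \<open>s\<close> they are homotopic to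
  the derivative of \<open>f\<close> at \<open>x\<close>, whose Brouwer degree is the sign of its determinant. So this sign is
  locally constant, and it is constant since the manifold is connected.
\<close>

section \<open>The degree of linear maps\<close>

definition coord_enum :: "nat \<Rightarrow> 'n::finite" where
  "coord_enum = (SOME b. bij_betw b {..<CARD('n)} UNIV)"

lemma bij_coord_enum: "bij_betw (coord_enum :: nat \<Rightarrow> 'n::finite) {..<CARD('n)} UNIV"
proof -
  have "\<exists>b :: nat \<Rightarrow> 'n. bij_betw b {..<CARD('n)} UNIV"
    using ex_bij_betw_nat_finite[of "UNIV :: 'n set"] by (simp add: atLeast0LessThan)
  then show ?thesis
    unfolding coord_enum_def by (rule someI_ex)
qed

text \<open>The Brouwer degree is defined for self-maps of \<open>nsphere\<close>, whose points are
  real sequences indexed by naturals. This map and \<open>seq_of_vec\<close> identify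
  \<open>nsphere (CARD('n) - 1)\<close> with the unit sphere of \<open>real ^ 'n\<close>.\<close>

definition vec_of_seq :: "(nat \<Rightarrow> real) \<Rightarrow> real ^ 'n::finite" where
  "vec_of_seq x = (\<chi> i. x (inv_into {..<CARD('n)} coord_enum i))"

text \<open>The default value 0 is forced, as points of \<open>nsphere\<close> vanish at all later
  indices.\<close>

definition seq_of_vec :: "real ^ 'n::finite \<Rightarrow> nat \<Rightarrow> real" where
  "seq_of_vec v k = (if k < CARD('n) then v $ coord_enum k else 0)"

lemma coord_enum_inv:
  "coord_enum (inv_into {..<CARD('n)} coord_enum (i::'n::finite)) = i"
  "inv_into {..<CARD('n)} coord_enum (i::'n::finite) < CARD('n)"
  "k < CARD('n) \<Longrightarrow> inv_into {..<CARD('n)} coord_enum (coord_enum k :: 'n::finite) = k"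
  using bij_betw_inv_into_right[OF bij_coord_enum, of i]
    bij_betwE[OF bij_betw_inv_into[OF bij_coord_enum]] bij_betw_inv_into_left[OF bij_coord_enum, of k]
  by auto

text \<open>The index of \<open>nsphere\<close> is the dimension of the sphere, one less than that
  of the space. Since \<open>CARD('n)\<close> is positive, the truncated subtraction is
  exact.\<close>

lemma atMost_card_minus1: "{..CARD('n::finite) - 1} = {..<CARD('n)}"
proof -
  have "Suc (CARD('n) - 1) = CARD('n)" by (simp add: Suc_pred')
  then show ?thesis by (simp flip: lessThan_Suc_atMost)
qed

lemma greater_card_minus1: "CARD('n::finite) - 1 < k \<longleftrightarrow> \<not> k < CARD('n)"
proof -
  have "Suc (CARD('n) - 1) = CARD('n)" by (simp add: Suc_pred')
  then show ?thesis by linarith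
qed

lemma vec_of_seq_of_vec [simp]: "vec_of_seq (seq_of_vec v) = (v :: real ^ 'n::finite)"
  by (simp add: vec_of_seq_def seq_of_vec_def coord_enum_inv vec_eq_iff)

lemma seq_of_vec_of_seq:
  assumes "x \<in> topspace (nsphere (CARD('n) - 1))"
  shows "seq_of_vec (vec_of_seq x :: real ^ 'n::finite) = x"
  using assms
  by (auto simp: vec_of_seq_def seq_of_vec_def coord_enum_inv fun_eq_iff nsphere greater_card_minus1 simp del: One_nat_def)

lemma norm_vec_of_seq:
  assumes "x \<in> topspace (nsphere (CARD('n) - 1))"
  shows "norm (vec_of_seq x :: real ^ 'n::finite) = 1"
proof -
  have "(\<Sum>i\<in>UNIV. (x (inv_into {..<CARD('n)} coord_enum (i::'n)))\<^sup>2) = (\<Sum>k<CARD('n). (x k)\<^sup>2)"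
    by (rule sum.reindex_bij_betw[OF bij_betw_inv_into[OF bij_coord_enum], of "\<lambda>k. (x k)\<^sup>2"])
  also have "\<dots> = 1"
    using assms by (simp add: nsphere flip: atMost_card_minus1)
  finally show ?thesis
    by (simp add: norm_vec_def L2_set_def vec_of_seq_def)
qed

lemma continuous_map_vec_of_seq:
  "continuous_map (nsphere (CARD('n) - 1)) (top_of_set (sphere 0 1)) (vec_of_seq :: _ \<Rightarrow> real ^ 'n::finite)"
proof -
  have "continuous_map (nsphere (CARD('n) - 1)) euclidean (vec_of_seq :: _ \<Rightarrow> real ^ 'n)"
    unfolding nsphere vec_of_seq_def euclidean_product_topology continuous_map_iff_continuous
    by (rule continuous_on_vec_lambda)
       (rule continuous_on_subset[OF continuous_on_product_coordinates subset_UNIV])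
  then show ?thesis
    using norm_vec_of_seq[where 'n='n] by (auto simp: continuous_map_in_subtopology)
qed

lemma continuous_map_seq_of_vec:
  "continuous_map (top_of_set (sphere 0 1)) (nsphere (CARD('n) - 1)) (seq_of_vec :: real ^ 'n::finite \<Rightarrow> _)"
proof -
  have *: "(\<Sum>k\<le>CARD('n) - 1. (seq_of_vec v k)\<^sup>2) = 1" if "norm v = 1" for v :: "real ^ 'n"
  proof -
    have "(\<Sum>k\<le>CARD('n) - 1. (seq_of_vec v k)\<^sup>2) = (\<Sum>k<CARD('n). (v $ coord_enum k)\<^sup>2)"
      unfolding atMost_card_minus1 by (simp add: seq_of_vec_def)
    also have "\<dots> = (\<Sum>i\<in>UNIV. (v $ i)\<^sup>2)"
      by (rule sum.reindex_bij_betw[OF bij_coord_enum])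
    finally show ?thesis
      using that by (simp add: norm_vec_def L2_set_def)
  qed
  have "continuous_on (sphere 0 1) (\<lambda>v :: real ^ 'n. seq_of_vec v k)" for k
    unfolding seq_of_vec_def
    by (cases "k < CARD('n)") (simp_all add: continuous_on_component)
  moreover have "seq_of_vec v k = 0" if "CARD('n) - 1 < k" for v :: "real ^ 'n" and k
    using that unfolding greater_card_minus1 seq_of_vec_def by simp
  ultimately show ?thesis
    unfolding nsphere continuous_map_in_subtopology continuous_map_componentwise_UNIV
    using * by auto
qed

text \<open>The degree of \<open>u \<mapsto> h u / \<bar>h u\<bar>\<close> on the unit sphere, meaningful when \<open>h\<close> has no zero there.\<close>

definition vdeg :: "(real ^ 'n \<Rightarrow> real ^ 'n::finite) \<Rightarrow> int" where
  "vdeg h = Brouwer_degree2 (CARD('n) - 1) (seq_of_vec \<circ> (sgn \<circ> h) \<circ> vec_of_seq)"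

section \<open>Homotopy invariance and multiplicativity of the degree\<close>

lemma continuous_map_sgn_sphere:
  fixes h :: "real ^ 'n \<Rightarrow> real ^ 'n::finite"
  assumes "continuous_on (sphere 0 1) h" "\<And>u. norm u = 1 \<Longrightarrow> h u \<noteq> 0"
  shows "continuous_map (top_of_set (sphere 0 1)) (top_of_set (sphere 0 1)) (sgn \<circ> h)"
  using assms by (auto simp: continuous_map_in_subtopology o_def norm_sgn intro!: continuous_intros)

lemma continuous_map_seq_transfer:
  fixes g :: "real ^ 'n \<Rightarrow> real ^ 'n::finite"
  assumes "continuous_map (top_of_set (sphere 0 1)) (top_of_set (sphere 0 1)) g"
  shows "continuous_map (nsphere (CARD('n) - 1)) (nsphere (CARD('n) - 1)) (seq_of_vec \<circ> g \<circ> vec_of_seq)"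
  using continuous_map_compose[OF continuous_map_vec_of_seq
      continuous_map_compose[OF assms continuous_map_seq_of_vec]]
  by (simp only: comp_assoc)

text \<open>Normalising by \<open>sgn\<close> turns a homotopy without zeros into one between
  self-maps of the sphere.\<close>

lemma vdeg_homotopy:
  fixes H :: "real \<Rightarrow> real ^ 'n \<Rightarrow> real ^ 'n::finite"
  assumes cont: "continuous_on ({0..1} \<times> sphere 0 1) (\<lambda>(t, u). H t u)"
    and nz: "\<And>t u. 0 \<le> t \<Longrightarrow> t \<le> 1 \<Longrightarrow> norm u = 1 \<Longrightarrow> H t u \<noteq> 0"
  shows "vdeg (H 0) = vdeg (H 1)"
proof -
  have c: "continuous_on ({0..1} \<times> sphere 0 1) (\<lambda>z. sgn (H (fst z) (snd z)))"
    using cont nz by (intro continuous_intros) (auto simp: case_prod_beta)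
  have hom: "homotopic_with (\<lambda>x. True) (top_of_set (sphere 0 1)) (top_of_set (sphere 0 1)) (sgn \<circ> H 0) (sgn \<circ> H 1)"
    unfolding homotopic_with_def
    by (rule exI[of _ "\<lambda>z. sgn (H (fst z) (snd z))"])
       (use c nz in \<open>auto simp: continuous_map_in_subtopology norm_sgn\<close>)
  have "homotopic_with (\<lambda>x. True) (nsphere (CARD('n) - 1)) (nsphere (CARD('n) - 1))
      ((seq_of_vec \<circ> (sgn \<circ> H 0)) \<circ> vec_of_seq) ((seq_of_vec \<circ> (sgn \<circ> H 1)) \<circ> vec_of_seq)"
    by (rule homotopic_with_compose_continuous_map_right[OF _ continuous_map_vec_of_seq])
       (rule homotopic_with_compose_continuous_map_left[OF hom continuous_map_seq_of_vec], auto)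
  then show ?thesis
    unfolding vdeg_def by (rule Brouwer_degree2_homotopic)
qed

lemma vdeg_homotopy_linear:
  fixes g h :: "real ^ 'n \<Rightarrow> real ^ 'n::finite"
  assumes "continuous_on (sphere 0 1) g" "continuous_on (sphere 0 1) h"
    and nz: "\<And>t u. 0 \<le> t \<Longrightarrow> t \<le> 1 \<Longrightarrow> norm u = 1 \<Longrightarrow> (1 - t) *\<^sub>R g u + t *\<^sub>R h u \<noteq> 0"
  shows "vdeg g = vdeg h"
proof -
  have "continuous_on ({0..1} \<times> sphere 0 1) (\<lambda>z :: real \<times> (real ^ 'n). (1 - fst z) *\<^sub>R g (snd z) + fst z *\<^sub>R h (snd z))"
    by (intro continuous_intros continuous_on_compose2[OF assms(1)] continuous_on_compose2[OF assms(2)]) auto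
  then show ?thesis
    using vdeg_homotopy[of "\<lambda>t u. (1 - t) *\<^sub>R g u + t *\<^sub>R h u"] nz
    by (simp add: case_prod_beta)
qed

lemma vdeg_id: "vdeg (id :: real ^ 'n \<Rightarrow> real ^ 'n::finite) = 1"
proof -
  have "vdeg (id :: real ^ 'n \<Rightarrow> real ^ 'n) = Brouwer_degree2 (CARD('n) - 1) id"
    unfolding vdeg_def
  proof (rule Brouwer_degree2_eq)
    fix x assume x: "x \<in> topspace (nsphere (CARD('n) - 1))"
    then show "(seq_of_vec \<circ> (sgn \<circ> (id :: real ^ 'n \<Rightarrow> real ^ 'n)) \<circ> vec_of_seq) x = id x"
      using norm_vec_of_seq[OF x] seq_of_vec_of_seq[OF x] by (simp add: sgn_div_norm)
  qed
  then show ?thesis by simp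
qed

text \<open>By homogeneity of \<open>g\<close>, normalising \<open>h u\<close> before applying
  \<open>g\<close> changes the result only by a positive factor, which the outer \<open>sgn\<close>
  removes. So the normalised composite is the composite of the normalised maps.\<close>

lemma vdeg_compose:
  fixes g h :: "real ^ 'n \<Rightarrow> real ^ 'n::finite"
  assumes g: "linear g" "inj g" and h: "linear h" "inj h"
  shows "vdeg (g \<circ> h) = vdeg g * vdeg h"
proof -
  have nz: "g u \<noteq> 0" "h u \<noteq> 0" if "norm u = 1" for u
    using that g h linear_injective_0 by fastforce+
  have cg: "continuous_map (top_of_set (sphere 0 1)) (top_of_set (sphere 0 1)) (sgn \<circ> g)"
    and ch: "continuous_map (top_of_set (sphere 0 1)) (top_of_set (sphere 0 1)) (sgn \<circ> h)"
    by (rule continuous_map_sgn_sphere; simp add: nz linear_continuous_on g h flip: linear_conv_bounded_linear)+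
  have "vdeg (g \<circ> h) = Brouwer_degree2 (CARD('n) - 1)
     ((seq_of_vec \<circ> (sgn \<circ> g) \<circ> vec_of_seq) \<circ> (seq_of_vec \<circ> (sgn \<circ> h) \<circ> vec_of_seq))"
    unfolding vdeg_def
  proof (rule Brouwer_degree2_eq)
    fix x assume x: "x \<in> topspace (nsphere (CARD('n) - 1))"
    let ?u = "vec_of_seq x :: real ^ 'n"
    have "sgn (g (sgn (h ?u))) = sgn (g (h ?u))"
      using nz[OF norm_vec_of_seq[OF x]]
      by (simp add: sgn_div_norm[of "h ?u"] linear_cmul[OF g(1)] sgn_scaleR)
    then show "(seq_of_vec \<circ> (sgn \<circ> (g \<circ> h)) \<circ> vec_of_seq) x =
       ((seq_of_vec \<circ> (sgn \<circ> g) \<circ> vec_of_seq) \<circ> (seq_of_vec \<circ> (sgn \<circ> h) \<circ> vec_of_seq)) x"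
      by simp
  qed
  also have "\<dots> = vdeg g * vdeg h"
    unfolding vdeg_def
    by (rule Brouwer_degree2_compose; rule continuous_map_seq_transfer; fact)
  finally show ?thesis .
qed

lemma vdeg_linear_nonzero:
  fixes g :: "real ^ 'n \<Rightarrow> real ^ 'n::finite"
  assumes "linear g" "inj g"
  shows "vdeg g \<noteq> 0"
proof -
  obtain h where h: "linear h" "\<And>x. h (g x) = x" "\<And>x. g (h x) = x"
    using linear_injective_isomorphism[OF assms] by blast
  have "inj h"
    by (metis h(3) injI)
  then have "vdeg (g \<circ> h) = vdeg g * vdeg h"
    using vdeg_compose assms h by blast
  moreover have "g \<circ> h = id"
    using h by auto
  ultimately show ?thesis
    by (auto simp: vdeg_id)
qed

section \<open>Degrees of elementary linear maps\<close>

definition coord_scale :: "'n \<Rightarrow> real \<Rightarrow> real ^ 'n \<Rightarrow> real ^ 'n::finite" where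
  "coord_scale k c x = (\<chi> i. if i = k then c * x $ i else x $ i)"

lemma linear_coord_scale: "linear (coord_scale k c)"
  by (rule linearI) (auto simp: coord_scale_def vec_eq_iff algebra_simps)

lemma inj_coord_scale: "c \<noteq> 0 \<Longrightarrow> inj (coord_scale k c)"
  by (rule injI) (auto simp: coord_scale_def vec_eq_iff split: if_splits)

definition coord_swap :: "'n \<Rightarrow> 'n \<Rightarrow> real ^ 'n \<Rightarrow> real ^ 'n::finite" where
  "coord_swap m n x = (\<chi> i. x $ Transposition.transpose m n i)"

lemma linear_coord_swap: "linear (coord_swap m n)"
  by (rule linearI) (auto simp: coord_swap_def vec_eq_iff)

lemma coord_swap_involutory: "coord_swap m n (coord_swap m n x) = x"
  by (auto simp: coord_swap_def vec_eq_iff)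

lemma inj_coord_swap: "inj (coord_swap m n)"
  by (metis coord_swap_involutory injI)

text \<open>Degrees are integers, hence commute, and the nonzero factor \<open>vdeg q\<close>
  cancels.\<close>

lemma vdeg_linear_conjugate:
  fixes g h q :: "real ^ 'n \<Rightarrow> real ^ 'n::finite"
  assumes "linear g" "inj g" "linear h" "inj h" "linear q" "inj q" and "g \<circ> q = q \<circ> h"
  shows "vdeg g = vdeg h"
proof -
  have "vdeg g * vdeg q = vdeg q * vdeg h"
    using vdeg_compose assms by metis
  then show ?thesis
    using vdeg_linear_nonzero assms by auto
qed

lemma vdeg_coord_reflection: "vdeg (coord_scale k (-1)) = - 1"
proof -
  let ?z = "coord_enum 0 :: 'a"
  have "vdeg (coord_scale ?z (-1)) =
     Brouwer_degree2 (CARD('a) - 1) (\<lambda>x i. if i = 0 then -x i else x i)"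
    unfolding vdeg_def
  proof (rule Brouwer_degree2_eq)
    fix x assume x: "x \<in> topspace (nsphere (CARD('a) - 1))"
    let ?u = "vec_of_seq x :: real ^ 'a"
    have n: "norm (coord_scale ?z (-1) ?u) = norm ?u"
      unfolding norm_vec_def L2_set_def by (rule arg_cong[of _ _ sqrt], rule sum.cong) (auto simp: coord_scale_def)
    have "coord_enum i = ?z \<longleftrightarrow> i = 0" if "i < CARD('a)" for i
      using that coord_enum_inv(3)[where 'n='a] zero_less_card_finite[where 'a='a] by metis
    moreover have "x i = seq_of_vec ?u i" for i
      using seq_of_vec_of_seq[OF x] by simp
    ultimately have "seq_of_vec (coord_scale ?z (-1) ?u) = (\<lambda>i. if i = 0 then -x i else x i)"
      by (auto simp: fun_eq_iff seq_of_vec_def coord_scale_def)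
    then show "(seq_of_vec \<circ> (sgn \<circ> coord_scale ?z (-1)) \<circ> vec_of_seq) x = (\<lambda>i. if i = 0 then -x i else x i)"
      using n norm_vec_of_seq[OF x] by (simp add: sgn_div_norm)
  qed
  then have "vdeg (coord_scale ?z (-1)) = - 1"
    by (simp add: Brouwer_degree2_reflection)
  \<comment> \<open>The known degree of a reflection concerns index 0; a swap of coordinates
    conjugates any other coordinate to it.\<close>
  moreover have "vdeg (coord_scale k (-1)) = vdeg (coord_scale ?z (-1))"
  proof (rule vdeg_linear_conjugate[OF linear_coord_scale inj_coord_scale linear_coord_scale inj_coord_scale
          linear_coord_swap inj_coord_swap])
    show "coord_scale k (-1) \<circ> coord_swap k ?z = coord_swap k ?z \<circ> coord_scale ?z (-1)"
      by (auto simp: fun_eq_iff vec_eq_iff coord_scale_def coord_swap_def Transposition.transpose_def split: if_splits)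
  qed auto
  ultimately show ?thesis by simp
qed

lemma linear_imp_continuous_on: "linear (g :: real ^ 'n \<Rightarrow> real ^ 'n::finite) \<Longrightarrow> continuous_on S g"
  by (simp add: linear_continuous_on linear_conv_bounded_linear)

text \<open>The segment from \<open>c\<close> to \<open>sgn c\<close> avoids 0, which leaves only
  the identity and the reflection.\<close>

lemma vdeg_coord_scale:
  assumes "c \<noteq> 0"
  shows "real_of_int (vdeg (coord_scale k c)) = sgn c"
proof -
  have "vdeg (coord_scale k c) = vdeg (coord_scale k (sgn c))"
  proof (rule vdeg_homotopy_linear)
    fix t :: real and u :: "real ^ 'a"
    assume t: "0 \<le> t" "t \<le> 1" and u: "norm u = 1"
    have "(1 - t) * c + t * sgn c = sgn c * ((1 - t) * \<bar>c\<bar> + t)"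
      by (auto simp: sgn_if abs_if algebra_simps)
    moreover have "(1 - t) * \<bar>c\<bar> + t > 0"
      using t assms by (cases "t = 1") (auto intro: add_pos_nonneg)
    ultimately have "(1 - t) * c + t * sgn c \<noteq> 0"
      using assms by (simp add: sgn_zero_iff)
    moreover have "(1 - t) *\<^sub>R coord_scale k c u + t *\<^sub>R coord_scale k (sgn c) u
       = coord_scale k ((1 - t) * c + t * sgn c) u"
      by (auto simp: coord_scale_def vec_eq_iff algebra_simps)
    moreover have "u \<noteq> 0"
      using u by auto
    ultimately show "(1 - t) *\<^sub>R coord_scale k c u + t *\<^sub>R coord_scale k (sgn c) u \<noteq> 0"
      using linear_injective_0[OF linear_coord_scale] inj_coord_scale by metis
  qed (auto intro: linear_imp_continuous_on linear_coord_scale)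
  moreover have "coord_scale k 1 = id"
    by (auto simp: coord_scale_def vec_eq_iff)
  ultimately show ?thesis
    using assms by (cases "c > 0") (auto simp: sgn_if vdeg_id vdeg_coord_reflection)
qed

lemma vdeg_coord_swap:
  assumes "m \<noteq> n"
  shows "vdeg (coord_swap m n) = - 1"
proof -
  \<comment> \<open>The columns of \<open>q\<close> are eigenvectors of the swap: the difference of
    the two basis vectors, with eigenvalue -1, and their sum, with eigenvalue 1. Hence
    \<open>q\<close> conjugates the swap to a reflection.\<close>
  define q :: "real ^ 'a \<Rightarrow> real ^ 'a" where
    "q x = (\<chi> i. if i = m then x $ m + x $ n else if i = n then x $ n - x $ m else x $ i)" for x
  have "linear q"
    by (rule linearI) (auto simp: q_def vec_eq_iff algebra_simps)
  moreover have "inj q"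
  proof (rule injI)
    fix x y assume "q x = q y"
    then have *: "q x $ i = q y $ i" for i by simp
    have "x $ i = y $ i" for i
      using *[of m] *[of n] *[of i] assms by (auto simp: q_def split: if_splits)
    then show "x = y" by (simp add: vec_eq_iff)
  qed
  moreover have "coord_swap m n \<circ> q = q \<circ> coord_scale m (-1)"
    using assms by (auto simp: fun_eq_iff vec_eq_iff coord_scale_def coord_swap_def q_def Transposition.transpose_def)
  ultimately have "vdeg (coord_swap m n) = vdeg (coord_scale m (-1))"
    by (intro vdeg_linear_conjugate[OF linear_coord_swap inj_coord_swap linear_coord_scale inj_coord_scale]) auto
  then show ?thesis
    by (simp add: vdeg_coord_reflection)
qed

lemma vdeg_diagonal:
  fixes c :: "'n::finite \<Rightarrow> real"
  assumes "finite S" "\<And>i. i \<in> S \<Longrightarrow> c i \<noteq> 0"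
  shows "real_of_int (vdeg (\<lambda>x :: real ^ 'n. \<chi> i. if i \<in> S then c i * x $ i else x $ i)) = (\<Prod>i\<in>S. sgn (c i))"
  using assms
proof (induction rule: finite_induct)
  case empty
  have "(\<lambda>x :: real ^ 'n. \<chi> i. if i \<in> {} then c i * x $ i else x $ i) = id"
    by (auto simp: vec_eq_iff)
  then show ?case by (simp add: vdeg_id)
next
  case (insert k S)
  let ?d = "\<lambda>x :: real ^ 'n. \<chi> i. if i \<in> S then c i * x $ i else x $ i"
  have "(\<lambda>x :: real ^ 'n. \<chi> i. if i \<in> insert k S then c i * x $ i else x $ i) = coord_scale k (c k) \<circ> ?d"
    using insert.hyps by (auto simp: fun_eq_iff vec_eq_iff coord_scale_def)
  moreover have "linear ?d"
    by (rule linearI) (auto simp: vec_eq_iff algebra_simps)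
  moreover have "inj ?d"
  proof (rule injI)
    fix x y assume "?d x = ?d y"
    then have "?d x $ i = ?d y $ i" for i by simp
    then have "x $ i = y $ i" for i
      using insert.prems by (auto split: if_splits dest!: spec[of _ i] simp: vec_eq_iff) (metis insertI2 mult_cancel_left)
    then show "x = y" by (simp add: vec_eq_iff)
  qed
  ultimately show ?case
    using insert vdeg_compose[OF linear_coord_scale inj_coord_scale, of "c k" ?d k] vdeg_coord_scale[of "c k" k]
    by simp
qed

lemma matrix_nonzero_imp_inj:
  "linear (g :: real ^ 'n \<Rightarrow> real ^ 'n::finite) \<Longrightarrow> det (matrix g) \<noteq> 0 \<Longrightarrow> inj g"
  using det_nz_iff_inj by blast

text \<open>Both sides are multiplicative under composition, so it suffices to compare them on the
  elementary maps that generate all linear maps.\<close>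

theorem vdeg_linear:
  fixes g :: "real ^ 'n \<Rightarrow> real ^ 'n::finite"
  assumes "linear g" "det (matrix g) \<noteq> 0"
  shows "real_of_int (vdeg g) = sgn (det (matrix g))"
proof -
  let ?P = "\<lambda>g :: real ^ 'n \<Rightarrow> real ^ 'n. det (matrix g) \<noteq> 0 \<longrightarrow> real_of_int (vdeg g) = sgn (det (matrix g))"
  have "?P g"
    using \<open>linear g\<close>
  proof (rule induct_linear_elementary; intro impI)
    fix f g :: "real ^ 'n \<Rightarrow> real ^ 'n"
    assume "linear f" "linear g" "?P f" "?P g" "det (matrix (f \<circ> g)) \<noteq> 0"
    moreover from this have "det (matrix f) \<noteq> 0" "det (matrix g) \<noteq> 0"
      by (simp_all add: matrix_compose det_mul)
    ultimately show "real_of_int (vdeg (f \<circ> g)) = sgn (det (matrix (f \<circ> g)))"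
      using vdeg_compose[of f g] matrix_nonzero_imp_inj[of f] matrix_nonzero_imp_inj[of g]
      by (simp add: matrix_compose det_mul sgn_mult)
  next
    fix f :: "real ^ 'n \<Rightarrow> real ^ 'n" and i
    assume "linear f" "\<And>x. f x $ i = 0" "det (matrix f) \<noteq> 0"
    \<comment> \<open>A map with a vanishing coordinate is not surjective, so this case contradicts
      the nonzero determinant.\<close>
    moreover from this have "surj f"
      using linear_injective_imp_surjective matrix_nonzero_imp_inj by blast
    ultimately show "real_of_int (vdeg f) = sgn (det (matrix f))"
      by (metis one_neq_zero surjE vec_component)
  next
    fix c :: "'n \<Rightarrow> real"
    let ?h = "\<lambda>x :: real ^ 'n. \<chi> i. c i * x $ i"
    assume nz: "det (matrix ?h) \<noteq> 0"
    have det: "det (matrix ?h) = (\<Prod>i\<in>UNIV. c i)"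
      by (subst det_diagonal) (auto simp: matrix_def axis_def)
    with nz have "\<And>i. c i \<noteq> 0"
      by auto
    then have "real_of_int (vdeg ?h) = (\<Prod>i\<in>UNIV. sgn (c i))"
      using vdeg_diagonal[of UNIV c] by simp
    also have "(\<Prod>i\<in>S. sgn (c i)) = sgn (\<Prod>i\<in>S. c i)" if "finite S" for S
      using that by (induction rule: finite_induct) (auto simp: sgn_mult)
    finally show "real_of_int (vdeg ?h) = sgn (det (matrix ?h))"
      by (simp add: det)
  next
    fix m n :: 'n
    assume mn: "m \<noteq> n"
    let ?h = "\<lambda>x :: real ^ 'n. \<chi> i. x $ Transposition.transpose m n i"
    have "matrix ?h = (\<chi> i. mat 1 $ Transposition.transpose m n i)"
      by (auto simp: matrix_def axis_def mat_def vec_eq_iff)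
    then have "det (matrix ?h) = of_int (sign (Transposition.transpose m n)) * det (mat 1 :: real ^ 'n ^ 'n)"
      using det_permute_rows[OF permutes_swap_id[of m UNIV n], of "mat 1 :: real ^ 'n ^ 'n"] by simp
    then have "det (matrix ?h) = - 1"
      by (simp add: sign_swap_id mn)
    moreover have "vdeg ?h = - 1"
      using vdeg_coord_swap[OF mn] unfolding coord_swap_def .
    ultimately show "real_of_int (vdeg ?h) = sgn (det (matrix ?h))"
      by simp
  next
    fix m n :: 'n
    assume mn: "m \<noteq> n"
    let ?h = "\<lambda>x :: real ^ 'n. \<chi> i. if i = m then x $ m + x $ n else x $ i"
    have "matrix ?h = (\<chi> k. if k = m then row m (mat 1) + 1 *s row n (mat 1) else row k (mat 1))"
      by (auto simp: matrix_def axis_def mat_def vec_eq_iff row_def)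
    then have det: "det (matrix ?h) = 1"
      using det_row_operation[OF mn, of "mat 1 :: real ^ 'n ^ 'n" 1] by simp
    \<comment> \<open>Shrinking the shear term to 0 is a homotopy through shears, all of which are
      injective.\<close>
    have "vdeg ?h = vdeg (id :: real ^ 'n \<Rightarrow> real ^ 'n)"
    proof (rule vdeg_homotopy_linear)
      fix t :: real and u :: "real ^ 'n"
      assume "norm u = 1"
      then obtain i where i: "u $ i \<noteq> 0"
        by (metis norm_zero vec_eq_iff zero_index zero_neq_one)
      have comp: "((1 - t) *\<^sub>R ?h u + t *\<^sub>R id u) $ k = (if k = m then u $ m + (1 - t) * u $ n else u $ k)" for k
        by (auto simp: algebra_simps)
      show "(1 - t) *\<^sub>R ?h u + t *\<^sub>R id u \<noteq> 0"
      proof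
        assume "(1 - t) *\<^sub>R ?h u + t *\<^sub>R id u = 0"
        then have 0: "(if k = m then u $ m + (1 - t) * u $ n else u $ k) = 0" for k
          using comp[of k] by simp
        show False
          using 0[of i] 0[of n] 0[of m] i mn by (cases "i = m") simp_all
      qed
    next
      show "continuous_on (sphere 0 1) ?h"
        by (rule linear_imp_continuous_on, rule linearI) (auto simp: vec_eq_iff algebra_simps)
      show "continuous_on (sphere 0 1) (id :: real ^ 'n \<Rightarrow> real ^ 'n)"
        by (rule linear_imp_continuous_on) (rule linear_id)
    qed
    then show "real_of_int (vdeg ?h) = sgn (det (matrix ?h))"
      by (simp add: det vdeg_id)
  qed
  then show ?thesis
    using assms by blast
qed

section \<open>Local homeomorphisms near the identity\<close>

definition locally_inj_at :: "('a::metric_space \<Rightarrow> 'b) \<Rightarrow> 'a \<Rightarrow> bool" where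
  "locally_inj_at f x \<longleftrightarrow> (\<exists>e>0. inj_on f (ball x e))"

lemma locally_inj_atE:
  assumes "locally_inj_at f x" "open S" "x \<in> S"
  obtains e where "e > 0" "ball x e \<subseteq> S" "inj_on f (ball x e)"
proof -
  obtain e where e: "e > 0" "inj_on f (ball x e)"
    using assms(1) unfolding locally_inj_at_def by blast
  obtain d where d: "d > 0" "ball x d \<subseteq> S"
    using assms open_contains_ball by metis
  have "ball x (min d e) \<subseteq> ball x e" "ball x (min d e) \<subseteq> S"
    using d by auto
  then show thesis
    using that[of "min d e"] e d inj_on_subset[OF e(2)] by auto
qed

lemma locally_inj_at_open:
  assumes "locally_inj_at f x"
  obtains e where "e > 0" "\<And>y. y \<in> ball x e \<Longrightarrow> locally_inj_at f y"
proof -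
  obtain e where e: "e > 0" "inj_on f (ball x e)"
    using assms unfolding locally_inj_at_def by blast
  have "locally_inj_at f y" if y: "y \<in> ball x e" for y
  proof -
    obtain d where "d > 0" "ball y d \<subseteq> ball x e"
      using openE[OF open_ball y] by blast
    then show ?thesis
      unfolding locally_inj_at_def using inj_on_subset[OF e(2)] by blast
  qed
  with e show thesis using that by blast
qed

lemma locally_inj_imp_open_image:
  fixes f :: "'a::euclidean_space \<Rightarrow> 'a"
  assumes "open S" "continuous_on S f" "\<And>x. x \<in> S \<Longrightarrow> locally_inj_at f x"
  shows "open (f ` S)"
proof -
  have "\<exists>T. open T \<and> f x \<in> T \<and> T \<subseteq> f ` S" if x: "x \<in> S" for x
  proof -
    obtain e where e: "e > 0" "ball x e \<subseteq> S" "inj_on f (ball x e)"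
      by (rule locally_inj_atE[OF assms(3)[OF x] assms(1) x])
    then have "open (f ` ball x e)"
      by (intro invariance_of_domain) (auto intro: continuous_on_subset[OF assms(2)])
    then show ?thesis
      using e by (intro exI[of _ "f ` ball x e"]) auto
  qed
  then show ?thesis
    by (subst open_subopen) blast
qed

lemma compact_isolated_finite:
  fixes F :: "'a::metric_space set"
  assumes "compact F" "\<And>x. x \<in> F \<Longrightarrow> \<exists>e>0. \<forall>y\<in>F \<inter> ball x e. y = x"
  shows "finite F"
proof (rule ccontr)
  assume "infinite F"
  then obtain x where x: "x \<in> F" "x islimpt F"
    using assms(1) compact_eq_Bolzano_Weierstrass by blast
  then obtain e where e: "e > 0" "\<forall>y\<in>F \<inter> ball x e. y = x"
    using assms(2) by blast
  then show False
    using x(2) unfolding islimpt_approachable by (auto simp: dist_commute)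
qed

text \<open>Fibres are compact by properness and discrete by local injectivity, hence finite.
  Disjoint balls around the points of a fibre then give the sheets, after the base neighbourhood is
  shrunk to exclude values taken outside these balls.\<close>

lemma proper_locally_inj_covering_space:
  fixes p :: "'a::euclidean_space \<Rightarrow> 'a"
  assumes C: "open C" and V: "open V" and cont: "continuous_on C p" and surj: "p ` C = V"
    and proper: "\<And>K. compact K \<Longrightarrow> K \<subseteq> V \<Longrightarrow> compact (C \<inter> p -` K)"
    and linj: "\<And>x. x \<in> C \<Longrightarrow> locally_inj_at p x"
  shows "covering_space C p V"
proof (rule covering_spaceI[OF cont surj])
  fix y assume y: "y \<in> V"
  define F where "F = C \<inter> p -` {y}"
  have cF: "compact F"
    unfolding F_def using proper[of "{y}"] y by auto
  have finF: "finite F"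
  proof (rule compact_isolated_finite[OF cF])
    fix x assume "x \<in> F"
    then obtain e where "e > 0" "inj_on p (ball x e)" "p x = y"
      using linj unfolding F_def locally_inj_at_def by auto
    then show "\<exists>e>0. \<forall>z\<in>F \<inter> ball x e. z = x"
      by (intro exI[of _ e]) (auto simp: F_def inj_on_def)
  qed
  have "\<exists>d>0. ball x d \<subseteq> C \<and> inj_on p (ball x d) \<and> (\<forall>x'\<in>F. x' \<noteq> x \<longrightarrow> 2 * d \<le> dist x x')" if x: "x \<in> F" for x
  proof -
    obtain e where e: "e > 0" "ball x e \<subseteq> C" "inj_on p (ball x e)"
      using locally_inj_atE[OF linj C] x unfolding F_def by blast
    obtain e' where e': "e' > 0" "\<forall>x'\<in>F. x' \<noteq> x \<longrightarrow> e' \<le> dist x x'"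
      using finite_set_avoid[OF finF] by blast
    \<comment> \<open>Half of the separation \<open>e'\<close> makes the balls around distinct
      points of the fibre disjoint.\<close>
    let ?d = "min e (e' / 2)"
    have "ball x ?d \<subseteq> ball x e" by auto
    then show ?thesis
      using e e' inj_on_subset[OF e(3)] by (intro exI[of _ ?d]) fastforce
  qed
  then obtain d where d: "\<And>x. x \<in> F \<Longrightarrow> d x > 0 \<and> ball x (d x) \<subseteq> C \<and> inj_on p (ball x (d x)) \<and>
       (\<forall>x'\<in>F. x' \<noteq> x \<longrightarrow> 2 * d x \<le> dist x x')"
    by metis
  define B where "B x = ball x (d x)" for x
  have B: "open (B x)" "B x \<subseteq> C" "inj_on p (B x)" "x \<in> B x" if "x \<in> F" for x
    using d[OF that] by (auto simp: B_def)
  have disj: "B x \<inter> B x' = {}" if "x \<in> F" "x' \<in> F" "x \<noteq> x'" for x x'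
  proof -
    have "2 * d x \<le> dist x x'" "2 * d x' \<le> dist x x'"
      using d that by (metis dist_commute)+
    then have "d x + d x' \<le> dist x x'" by simp
    then show ?thesis
      unfolding B_def by (simp add: disjoint_ballI)
  qed
  have opB: "open (p ` B x)" if "x \<in> F" for x
    using B[OF that] by (intro invariance_of_domain) (auto intro: continuous_on_subset[OF cont])
  obtain t0 where t0: "t0 > 0" "cball y t0 \<subseteq> V"
    using V y open_contains_cball by metis
  define K where "K = C \<inter> p -` cball y t0"
  have "compact K"
    unfolding K_def using t0 by (intro proper) auto
  then have "compact (K - (\<Union>x\<in>F. B x))"
    by (intro compact_diff open_UN ballI B)
  then have cl: "closed (p ` (K - (\<Union>x\<in>F. B x)))"
    by (intro compact_imp_closed compact_continuous_image) (auto simp: K_def intro: continuous_on_subset[OF cont])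
  \<comment> \<open>The second factor confines all preimages of \<open>T\<close> to the balls, and
    the third makes each ball map onto \<open>T\<close>. Compactness of \<open>K\<close> and
    finiteness of \<open>F\<close> keep \<open>T\<close> open.\<close>
  define T where "T = ball y t0 \<inter> - p ` (K - (\<Union>x\<in>F. B x)) \<inter> (\<Inter>x\<in>F. p ` B x)"
  have oT: "open T"
    unfolding T_def using cl finF opB by (intro open_Int open_INT) auto
  have TV: "T \<subseteq> V"
    unfolding T_def using t0 by force
  have "y \<in> p ` B x" if "x \<in> F" for x
    using that B(4)[OF that] by (auto simp: F_def)
  moreover have "y \<notin> p ` (K - (\<Union>x\<in>F. B x))"
    using B(4) by (auto simp: F_def K_def)
  ultimately have yT: "y \<in> T"
    unfolding T_def using t0 by auto
  have cover: "\<exists>x\<in>F. z \<in> B x" if "z \<in> C" "p z \<in> T" for z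
    using that unfolding T_def K_def by auto
  let ?v = "(\<lambda>x. B x \<inter> p -` T) ` F"
  show "\<exists>T. y \<in> T \<and> openin (top_of_set V) T \<and>
          (\<exists>v. \<Union>v = C \<inter> p -` T \<and> (\<forall>u\<in>v. openin (top_of_set C) u) \<and> pairwise disjnt v \<and> (\<forall>u\<in>v. \<exists>q. homeomorphism u T p q))"
  proof (intro exI[of _ T] conjI exI[of _ ?v])
    show "y \<in> T" by fact
    show "openin (top_of_set V) T"
      using oT TV V by (simp add: open_subset)
    show "\<Union>?v = C \<inter> p -` T"
    proof (intro equalityI subsetI)
      fix z assume "z \<in> C \<inter> p -` T"
      then show "z \<in> \<Union>?v" using cover[of z] by auto
    next
      fix z assume "z \<in> \<Union>?v"
      then show "z \<in> C \<inter> p -` T" using B(2) by auto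
    qed
    have oB: "open (B x \<inter> p -` T)" if "x \<in> F" for x
      using continuous_open_preimage[OF continuous_on_subset[OF cont B(2)[OF that]] B(1)[OF that] oT] .
    then show "\<forall>u\<in>?v. openin (top_of_set C) u"
      using B(2) by (auto intro!: open_subset)
    show "pairwise disjnt ?v"
      unfolding pairwise_image pairwise_def
      using disj unfolding disjnt_def by auto
    show "\<forall>u\<in>?v. \<exists>q. homeomorphism u T p q"
    proof clarify
      fix x assume x: "x \<in> F"
      have "T \<subseteq> p ` B x"
        unfolding T_def using x by auto
      then have im: "p ` (B x \<inter> p -` T) = T"
        by auto
      have "inj_on p (B x \<inter> p -` T)" "continuous_on (B x \<inter> p -` T) p"
        using B[OF x] by (auto intro: inj_on_subset continuous_on_subset[OF cont])
      then obtain q where "homeomorphism (B x \<inter> p -` T) (p ` (B x \<inter> p -` T)) p q"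
        using invariance_of_domain_homeomorphism[OF oB[OF x], of p] by blast
      then show "\<exists>q. homeomorphism (B x \<inter> p -` T) T p q"
        unfolding im by blast
    qed
  qed
qed

text \<open>A displacement of at most \<open>r / 8\<close> keeps the preimage of the ball of radius
  \<open>r / 2\<close> inside the closed ball of radius \<open>5 * r / 8\<close>, so
  \<open>h\<close> is proper over that smaller ball. Restricted to a component of the preimage it is
  a connected covering of a simply connected set, hence injective. The component contains the ball
  of radius \<open>r / 4\<close> because \<open>r / 4 + r / 8 < r / 2\<close>.\<close>

lemma near_identity_locally_inj_imp_inj_on:
  fixes h :: "'a::euclidean_space \<Rightarrow> 'a"
  assumes r: "r > 0" and cont: "continuous_on (ball u r) h"
    and linj: "\<And>x. x \<in> ball u r \<Longrightarrow> locally_inj_at h x"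
    and near: "\<And>x. x \<in> ball u r \<Longrightarrow> dist (h x) x \<le> r / 8"
  shows "inj_on h (ball u (r / 4))"
proof -
  define V where "V = ball u (r / 2)"
  define D where "D = ball u r \<inter> h -` V"
  define C where "C = connected_component_set D u"
  have V: "open V" "connected V" "u \<in> V" "simply_connected V" "locally path_connected V"
    using r by (auto simp: V_def convex_imp_simply_connected convex_imp_locally_path_connected)
  have "open D"
    unfolding D_def using cont V by (simp add: continuous_open_preimage)
  then have oC: "open C"
    unfolding C_def by (rule open_connected_component)
  have CD: "C \<subseteq> D" and conC: "connected C"
    unfolding C_def by (auto simp: connected_component_subset)
  have Dsub: "D \<subseteq> cball u (5 * r / 8)"
  proof
    fix x assume "x \<in> D"
    then have "dist u (h x) < r / 2" "dist (h x) x \<le> r / 8"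
      using near by (auto simp: D_def V_def)
    then show "x \<in> cball u (5 * r / 8)"
      using dist_triangle[of u x "h x"] by simp
  qed
  have small: "ball u (r / 4) \<subseteq> D"
  proof
    fix x assume x: "x \<in> ball u (r / 4)"
    then have "x \<in> ball u r" using r by auto
    then have "dist (h x) x \<le> r / 8" by (rule near)
    then show "x \<in> D"
      using x dist_triangle[of u "h x" x] r by (auto simp: D_def V_def dist_commute)
  qed
  then have smallC: "ball u (r / 4) \<subseteq> C"
    unfolding C_def using r by (intro connected_component_maximal) auto
  then have uC: "u \<in> C" using r by auto
  have contC: "continuous_on C h" and linjC: "\<And>x. x \<in> C \<Longrightarrow> locally_inj_at h x"
    using CD cont linj by (auto simp: D_def intro: continuous_on_subset)
  have proper: "compact (C \<inter> h -` K)" if K: "compact K" "K \<subseteq> V" for K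
  proof -
    have sub: "cball u (5 * r / 8) \<subseteq> ball u r" using r by auto
    \<comment> \<open>A component need not be closed in the whole space, but the preimage of
      \<open>K\<close> in the closed ball lies in \<open>D\<close>, where \<open>C\<close> is
      relatively closed.\<close>
    have "closedin (top_of_set D) C"
      unfolding C_def by (rule closedin_connected_component)
    then obtain T where T: "closed T" "C = D \<inter> T"
      by (auto simp: closedin_closed)
    have "compact (cball u (5 * r / 8) \<inter> h -` K)"
      using K continuous_on_subset[OF cont sub]
      by (metis compact_cball compact_continuous_image_eq compact_eq_bounded_closed bounded_Int closed_cball continuous_closed_preimage)
    then have "compact (T \<inter> (cball u (5 * r / 8) \<inter> h -` K))"
      using T by (simp add: closed_Int_compact)
    moreover have "C \<inter> h -` K = T \<inter> (cball u (5 * r / 8) \<inter> h -` K)"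
      using T Dsub K sub by (auto simp: D_def)
    ultimately show ?thesis by simp
  qed
  have hCV: "h ` C \<subseteq> V"
    using CD by (auto simp: D_def)
  have surj: "h ` C = V"
  proof -
    have "openin (top_of_set V) (h ` C)"
      using locally_inj_imp_open_image[OF oC contC linjC] hCV by (simp add: open_subset)
    moreover have "closedin (top_of_set V) (h ` C)"
    proof -
      have "y \<in> h ` C" if y: "y \<in> V" "y \<in> closure (h ` C)" for y
      proof -
        \<comment> \<open>Near \<open>y\<close> the image of \<open>C\<close> is that of the
          preimage of a small closed ball, which is compact by properness. So the image is closed in
          \<open>V\<close>.\<close>
        obtain t where t: "t > 0" "cball y t \<subseteq> V"
          using V y open_contains_cball by metis
        have "closed (h ` (C \<inter> h -` cball y t))"
          using t proper[of "cball y t"]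
          by (intro compact_imp_closed compact_continuous_image) (auto intro: continuous_on_subset[OF contC])
        moreover have "y \<in> closure (h ` (C \<inter> h -` cball y t))"
          unfolding closure_approachable
        proof (intro allI impI)
          fix e :: real assume "e > 0"
          then obtain x where "x \<in> C" "dist (h x) y < min e t"
            using y(2) t unfolding closure_approachable by (metis imageE min_less_iff_conj)
          then show "\<exists>z\<in>h ` (C \<inter> h -` cball y t). dist z y < e"
            by (intro bexI[of _ "h x"]) (auto simp: dist_commute)
        qed
        ultimately show ?thesis by auto
      qed
      then have "V \<inter> closure (h ` C) = h ` C"
        using hCV closure_subset by fastforce
      then show ?thesis
        by (metis closed_closure closedin_closed)
    qed
    ultimately show ?thesis
      using V(2) uC connected_clopen by blast
  qed
  have cov: "covering_space C h V"
    by (rule proper_locally_inj_covering_space[OF oC V(1) contC surj proper linjC])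
  \<comment> \<open>Lifting the identity of \<open>V\<close> gives a section \<open>g\<close>. Then
    \<open>g \<circ> h\<close> and the identity of \<open>C\<close> are lifts of \<open>h\<close>
    that agree at \<open>u\<close>, so they coincide on the connected set \<open>C\<close>.\<close>
  obtain g where g: "continuous_on V g" "g \<in> V \<rightarrow> C" "g (h u) = u" "\<And>y. y \<in> V \<Longrightarrow> h (g y) = y"
    using covering_space_lift_strong[OF cov uC, of "h u" V id] V hCV uC by auto
  have "g (h x) = x" if "x \<in> C" for x
  proof -
    have "continuous_on C (g \<circ> h)"
      using contC g(1) surj continuous_on_compose by metis
    then have "(g \<circ> h) x = id x"
      by (rule covering_space_lift_unique[OF cov, where f=h and a=u and T=C, rotated 3])
         (use g contC hCV conC uC that in \<open>auto simp: Pi_iff\<close>)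
    then show ?thesis by simp
  qed
  then have "inj_on h C"
    by (metis inj_onI)
  then show ?thesis
    using smallC inj_on_subset by blast
qed

section \<open>Local injectivity of differentiable maps\<close>

text \<open>An injective linear map is bounded below by some \<open>B > 0\<close>, and the remainder
  costs at most half of it. One index \<open>n\<close> controls both radius and slope, so that
  countably many conditions cover all points, as the Baire argument requires.\<close>

lemma has_derivative_inj_lower_bound:
  fixes f :: "'a::euclidean_space \<Rightarrow> 'a"
  assumes "(f has_derivative L) (at x)" "inj L"
  shows "\<exists>n. \<forall>y. dist y x < 1 / real (Suc n) \<longrightarrow> norm (y - x) / real (Suc n) \<le> norm (f y - f x)"
proof -
  have "linear L"
    using assms(1) has_derivative_linear by blast
  then obtain B where B: "B > 0" "\<And>z. B * norm z \<le> norm (L z)"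
    using linear_inj_bounded_below_pos assms(2) by blast
  obtain d where d: "d > 0" "\<And>y. norm (y - x) < d \<Longrightarrow> norm (f y - f x - L (y - x)) \<le> B / 2 * norm (y - x)"
    using assms(1) B(1) unfolding has_derivative_at_alt by (metis half_gt_zero)
  obtain n where n: "inverse (real (Suc n)) < min d (B / 2)"
    using reals_Archimedean[of "min d (B / 2)"] d B by auto
  have "norm (y - x) / real (Suc n) \<le> norm (f y - f x)" if "dist y x < 1 / real (Suc n)" for y
  proof -
    have "norm (y - x) < d"
      using that n by (simp add: dist_norm inverse_eq_divide)
    then have "B * norm (y - x) - B / 2 * norm (y - x) \<le> norm (f y - f x)"
      using B(2)[of "y - x"] d(2)[of y] norm_triangle_ineq2[of "L (y - x)" "L (y - x) - (f y - f x)"]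
      by (simp add: norm_minus_commute)
    moreover have "norm (y - x) / real (Suc n) \<le> B / 2 * norm (y - x)"
      using n mult_right_mono[of "inverse (real (Suc n))" "B / 2" "norm (y - x)"]
      by (simp add: inverse_eq_divide)
    ultimately show ?thesis by (simp add: algebra_simps)
  qed
  then show ?thesis by blast
qed

text \<open>
  \<open>f\<close> may fail to be injective near \<open>x\<close>, which only lies on the boundary of the ball. The point \<open>u\<close> is
  taken on the segment from \<open>x\<close> to \<open>w\<close> at distance \<open>\<delta>\<close> from \<open>x\<close>: all preimages of \<open>f u\<close> are then within
  a small multiple of \<open>\<delta>\<close> of \<open>u\<close>, where \<open>f\<close> composed with the inverse of \<open>L\<close> is near the identity.
\<close>

lemma unique_preimage_near_tangent_point:
  fixes f :: "'a::euclidean_space \<Rightarrow> 'a"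
  assumes der: "(f has_derivative L) (at x)" "inj L" and c: "c > 0"
    and lower: "\<And>v. v \<in> B \<Longrightarrow> c * norm (v - x) \<le> norm (f v - f x)"
    and w: "w \<noteq> x" and cont: "continuous_on (ball w (dist w x)) f"
    and linj: "\<And>u. u \<in> ball w (dist w x) \<Longrightarrow> locally_inj_at f u"
  shows "\<exists>u\<in>ball w (dist w x). \<forall>v\<in>B. f v = f u \<longrightarrow> v = u"
proof -
  have lin: "linear L"
    using der(1) has_derivative_linear by blast
  obtain G where G: "linear G" "\<And>z. G (L z) = z" "\<And>z. L (G z) = z"
    using linear_injective_isomorphism[OF lin der(2)] by blast
  obtain KG where KG: "KG > 0" "\<And>z. norm (G z) \<le> KG * norm z"
    using linear_bounded_pos[OF G(1)] by blast
  obtain KL where KL: "KL > 0" "\<And>z. norm (L z) \<le> KL * norm z"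
    using linear_bounded_pos[OF lin] by blast
  \<comment> \<open>The preimages of \<open>f u\<close> in \<open>B\<close> will lie within
    \<open>(KL + 1) / c * del\<close> of \<open>x\<close>. The summand 2 leaves room for
    \<open>u\<close> and for the points of \<open>ball u del\<close>, at distance at most
    \<open>2 * del\<close> from \<open>x\<close>.\<close>
  define Q where "Q = (KL + 1) / c + 2"
  have Q: "Q > 2" using KL c by (simp add: Q_def)
  \<comment> \<open>With this error \<open>h\<close> moves points within \<open>Q * del\<close> of
    \<open>x\<close> by at most \<open>del / 8\<close>, the bound under which a locally injective
    map is injective on \<open>ball u (del / 4)\<close>.\<close>
  define eta where "eta = min 1 (1 / (8 * KG * Q))"
  have eta: "eta > 0" "eta \<le> 1" "KG * eta * Q \<le> 1 / 8"
  proof -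
    show "eta > 0" "eta \<le> 1" using KG Q by (auto simp: eta_def)
    have "eta \<le> 1 / (8 * KG * Q)" by (simp add: eta_def)
    then show "KG * eta * Q \<le> 1 / 8" using KG Q by (simp add: field_simps)
  qed
  obtain d0 where d0: "d0 > 0" "\<And>y. norm (y - x) < d0 \<Longrightarrow> norm (f y - f x - L (y - x)) \<le> eta * norm (y - x)"
    using der(1) eta(1) unfolding has_derivative_at_alt by metis
  define rho where "rho = dist w x"
  have rho: "rho > 0" using w by (simp add: rho_def)
  define s where "s = min (1/2) (d0 / (2 * Q * rho))"
  have s: "0 < s" "s < 1" using d0 Q rho by (auto simp: s_def)
  define del where "del = s * rho"
  have del: "del > 0" "Q * del < d0"
  proof -
    show "del > 0" using s rho by (simp add: del_def)
    have "s \<le> d0 / (2 * Q * rho)" by (simp add: s_def)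
    then have "Q * (s * rho) \<le> d0 / 2" using Q rho by (simp add: field_simps)
    then show "Q * del < d0" using d0 by (simp add: del_def)
  qed
  define u where "u = x + s *\<^sub>R (w - x)"
  have ux: "norm (u - x) = del"
    using s by (simp add: u_def del_def rho_def dist_norm)
  \<comment> \<open>The small ball touches the large one from inside at \<open>x\<close>, so
    \<open>f\<close> is locally injective on all of it.\<close>
  have sub: "ball u del \<subseteq> ball w rho"
  proof
    fix y assume y: "y \<in> ball u del"
    have "w - u = (1 - s) *\<^sub>R (w - x)"
      by (simp add: u_def algebra_simps)
    then have "dist w u = (1 - s) * rho"
      using s by (simp add: dist_norm rho_def)
    then show "y \<in> ball w rho"
      using y dist_triangle[of w y u] by (simp add: del_def algebra_simps)
  qed
  \<comment> \<open>Undoing the derivative makes \<open>f\<close> near the identity around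
    \<open>x\<close> without changing its fibres.\<close>
  define h where "h y = x + G (f y - f x)" for y
  have h_diff: "h y - y = G (f y - f x - L (y - x))" for y
    using G by (simp add: h_def linear_diff[OF G(1)])
  have h_near: "dist (h y) y \<le> KG * (eta * norm (y - x))" if "norm (y - x) < d0" for y
  proof -
    have "norm (G (f y - f x - L (y - x))) \<le> KG * norm (f y - f x - L (y - x))"
      by (rule KG)
    also have "\<dots> \<le> KG * (eta * norm (y - x))"
      using d0(2)[OF that] KG(1) by simp
    finally show ?thesis by (simp add: dist_norm h_diff)
  qed
  have "inj G"
    using G by (metis injI)
  have inj_h: "inj_on h (ball u (del / 4))"
  proof (rule near_identity_locally_inj_imp_inj_on[OF del(1)])
    show "continuous_on (ball u del) h"
      unfolding h_def
      using sub cont continuous_on_subset linear_continuous_on_compose[OF _ G(1)]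
      by (intro continuous_intros continuous_on_compose2[OF linear_continuous_on[OF linear_linear[THEN iffD2, OF G(1)], of UNIV]])
         (auto simp: rho_def)
    show "locally_inj_at h y" if "y \<in> ball u del" for y
    proof -
      have "locally_inj_at f y"
        using that sub linj by (auto simp: rho_def)
      then show ?thesis
        unfolding locally_inj_at_def h_def inj_on_def using injD[OF \<open>inj G\<close>] by fastforce
    qed
    show "dist (h y) y \<le> del / 8" if "y \<in> ball u del" for y
    proof -
      have "norm (y - x) \<le> 2 * del"
        using that ux dist_triangle[of y x u] by (simp add: dist_norm norm_minus_commute)
      moreover have "2 * del < Q * del" using Q del by simp
      ultimately have y: "norm (y - x) \<le> Q * del" "norm (y - x) < d0"
        using del(2) by linarith+
      have "KG * (eta * norm (y - x)) \<le> KG * (eta * (Q * del))"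
        using y(1) KG eta by (intro mult_left_mono) auto
      also have "\<dots> = (KG * eta * Q) * del" by simp
      also have "\<dots> \<le> 1 / 8 * del"
        using eta(3) del(1) by (intro mult_right_mono) auto
      finally show ?thesis using h_near[OF y(2)] by simp
    qed
  qed
  have "v = u" if v: "v \<in> B" "f v = f u" for v
  proof -
    have "1 * del \<le> Q * del" using Q del by (intro mult_right_mono) auto
    then have ud0: "norm (u - x) < d0" using ux del by linarith
    have "norm (f u - f x) \<le> norm (f u - f x - L (u - x)) + norm (L (u - x))"
      by (metis diff_add_cancel norm_triangle_ineq)
    also have "\<dots> \<le> eta * del + KL * del"
      using d0(2)[OF ud0] KL(2)[of "u - x"] ux by simp
    also have "\<dots> \<le> (KL + 1) * del"
      using eta(2) del(1) by (simp add: algebra_simps)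
    finally have "c * norm (v - x) \<le> (KL + 1) * del"
      using lower[OF v(1)] v(2) by simp
    then have vx: "norm (v - x) \<le> (KL + 1) / c * del"
      using c by (simp add: field_simps)
    moreover have "(KL + 1) / c * del + 2 * del = Q * del"
      by (simp add: Q_def algebra_simps)
    ultimately have sum: "norm (v - x) + norm (u - x) \<le> Q * del" and vd0: "norm (v - x) < d0"
      using del ux by linarith+
    \<comment> \<open>Since \<open>h v = h u\<close>, the distance from \<open>v\<close> to
      \<open>u\<close> is bounded by the two displacements, which are small.\<close>
    have "v - u = (h u - u) - (h v - v)"
      using v(2) by (simp add: h_def)
    then have "norm (v - u) \<le> dist (h u) u + dist (h v) v"
      unfolding dist_norm using norm_triangle_ineq4 by metis
    also have "\<dots> \<le> KG * eta * (norm (v - x) + norm (u - x))"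
      using h_near[OF ud0] h_near[OF vd0] by (simp add: algebra_simps)
    also have "\<dots> \<le> KG * eta * (Q * del)"
      using sum KG eta by (intro mult_left_mono) auto
    also have "\<dots> = (KG * eta * Q) * del" by simp
    also have "\<dots> \<le> 1 / 8 * del"
      using eta(3) del(1) by (intro mult_right_mono) auto
    finally have "v \<in> ball u (del / 4)"
      using del(1) by (simp add: dist_norm norm_minus_commute)
    moreover have "h v = h u" using v(2) by (simp add: h_def)
    ultimately show ?thesis
      using inj_h del(1) by (auto dest: inj_onD)
  qed
  moreover have "u \<in> ball w rho"
    using subsetD[OF sub centre_in_ball[THEN iffD2, OF del(1)]] .
  ultimately show ?thesis
    unfolding rho_def by blast
qed

text \<open>Uniqueness of the preimage is open because \<open>B\<close> without a small ball is
  compact, so its image misses a neighbourhood of the value. Non-uniqueness is open because a second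
  preimage persists by invariance of domain, which is why \<open>pre\<close> asks it to be interior
  and a point of local injectivity.\<close>

lemma unique_preimage_propagates:
  fixes f :: "'a::euclidean_space \<Rightarrow> 'a"
  assumes B: "compact B" "continuous_on B f" and D: "open D" "connected D" "D \<subseteq> B"
    and linjD: "\<And>u. u \<in> D \<Longrightarrow> locally_inj_at f u"
    and pre: "\<And>u v. u \<in> D \<Longrightarrow> v \<in> B \<Longrightarrow> f v = f u \<Longrightarrow> v \<in> interior B \<and> locally_inj_at f v"
    and u0: "u0 \<in> D" "\<And>v. v \<in> B \<Longrightarrow> f v = f u0 \<Longrightarrow> v = u0" and u1: "u1 \<in> D"
    and v1: "v1 \<in> B" "f v1 = f u1"
  shows "v1 = u1"
proof -
  define P where "P = {u \<in> D. \<forall>v\<in>B. f v = f u \<longrightarrow> v = u}"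
  have contD: "continuous_on D f" using B D continuous_on_subset by blast
  have "open (D - P)"
  proof (subst open_subopen, intro ballI)
    fix u assume "u \<in> D - P"
    then obtain v where u: "u \<in> D" and v: "v \<in> B" "f v = f u" "v \<noteq> u"
      by (auto simp: P_def)
    have vi: "v \<in> interior B" "locally_inj_at f v"
      using pre[OF u v(1,2)] by auto
    \<comment> \<open>Disjoint neighbourhoods keep the persisting preimage in \<open>S\<close>
      different from the point of \<open>U\<close>.\<close>
    obtain S U where SU: "open S" "open U" "v \<in> S" "u \<in> U" "S \<inter> U = {}"
      using hausdorff[OF v(3)] by blast
    obtain e where e: "e > 0" "ball v e \<subseteq> interior B \<inter> S" "inj_on f (ball v e)"
      by (rule locally_inj_atE[OF vi(2), of "interior B \<inter> S"]) (use vi SU in auto)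
    have "ball v e \<subseteq> B" using e interior_subset by blast
    then have "open (f ` ball v e)"
      using e B(2) by (intro invariance_of_domain) (auto intro: continuous_on_subset)
    then have "open (D \<inter> U \<inter> f -` (f ` ball v e))"
      by (intro continuous_open_preimage continuous_on_subset[OF contD]) (use D SU in auto)
    moreover have "u \<in> D \<inter> U \<inter> f -` (f ` ball v e)"
      using u v SU e by (auto intro!: image_eqI[of _ _ v])
    moreover have "D \<inter> U \<inter> f -` (f ` ball v e) \<subseteq> D - P"
    proof
      fix z assume z: "z \<in> D \<inter> U \<inter> f -` (f ` ball v e)"
      then obtain v' where "v' \<in> ball v e" "f v' = f z" by auto
      moreover from this have "v' \<in> B" "v' \<noteq> z"
        using e SU z \<open>ball v e \<subseteq> B\<close> by auto
      ultimately show "z \<in> D - P" using z by (auto simp: P_def)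
    qed
    ultimately show "\<exists>T. open T \<and> u \<in> T \<and> T \<subseteq> D - P" by blast
  qed
  moreover have "open P"
  proof (subst open_subopen, intro ballI)
    fix u assume u: "u \<in> P"
    then have uD: "u \<in> D" by (simp add: P_def)
    obtain e where e: "e > 0" "ball u e \<subseteq> D" "inj_on f (ball u e)"
      by (rule locally_inj_atE[OF linjD[OF uD] D(1) uD])
    have "compact (B - ball u e)"
      using B(1) by (rule compact_diff) simp
    then have "closed (f ` (B - ball u e))"
      using B(2) by (intro compact_imp_closed compact_continuous_image) (auto intro: continuous_on_subset)
    then have "open (ball u e \<inter> f -` (- f ` (B - ball u e)))"
      using e by (intro continuous_open_preimage continuous_on_subset[OF contD]) auto
    moreover have "u \<in> ball u e \<inter> f -` (- f ` (B - ball u e))"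
      using e u by (auto simp: P_def)
    moreover have "ball u e \<inter> f -` (- f ` (B - ball u e)) \<subseteq> P"
    proof
      fix z assume z: "z \<in> ball u e \<inter> f -` (- f ` (B - ball u e))"
      have "v = z" if "v \<in> B" "f v = f z" for v
      proof -
        have "v \<in> ball u e" using z that by (metis DiffI IntD2 ComplD image_eqI vimageD)
        then show ?thesis using e(3) z that by (auto dest: inj_onD)
      qed
      then show "z \<in> P" using z e by (auto simp: P_def)
    qed
    ultimately show "\<exists>T. open T \<and> u \<in> T \<and> T \<subseteq> P" by blast
  qed
  moreover have "u0 \<in> P" using u0 by (simp add: P_def)
  moreover have "P \<subseteq> D" by (auto simp: P_def)
  ultimately have "D - P = {}"
    using D(2) connectedD[of D P "D - P"] u0(1) by blast
  then show ?thesis using u1 v1 by (auto simp: P_def)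
qed

text \<open>The derivative may vary discontinuously, so a lower bound on slopes holds at each point
  but not uniformly. Baire's theorem makes it uniform on a piece of the failure set.\<close>

theorem differentiable_invertible_imp_locally_inj:
  fixes f :: "'a::euclidean_space \<Rightarrow> 'a"
  assumes Om: "open \<Omega>" and der: "\<And>x. x \<in> \<Omega> \<Longrightarrow> (f has_derivative f' x) (at x)"
    and inj: "\<And>x. x \<in> \<Omega> \<Longrightarrow> inj (f' x)" and a: "a \<in> \<Omega>"
  shows "locally_inj_at f a"
proof (rule ccontr)
  assume bad: "\<not> locally_inj_at f a"
  have cont: "continuous_on \<Omega> f"
    using der by (meson continuous_at_imp_continuous_on has_derivative_continuous)
  define E where "E = {x \<in> \<Omega>. \<not> locally_inj_at f x}"
  have aE: "a \<in> E" using a bad by (simp add: E_def)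
  obtain r where r: "r > 0" "cball a r \<subseteq> \<Omega>"
    using Om a open_contains_cball by metis
  \<comment> \<open>Baire's theorem needs a closed set. The closure stays in \<open>E\<close>, since
    it lies in \<open>cball a r\<close> and local injectivity is an open condition.\<close>
  define K where "K = closure (E \<inter> ball a r)"
  have KE: "K \<subseteq> E"
  proof
    fix x assume x: "x \<in> K"
    have "K \<subseteq> cball a r"
      unfolding K_def by (rule closure_minimal) auto
    then have x\<Omega>: "x \<in> \<Omega>" using x r by blast
    have "\<not> locally_inj_at f x"
    proof
      assume "locally_inj_at f x"
      then obtain e where e: "e > 0" "\<And>y. y \<in> ball x e \<Longrightarrow> locally_inj_at f y"
        using locally_inj_at_open by blast
      then obtain y where "y \<in> E" "dist y x < e"
        using x unfolding K_def closure_approachable by blast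
      then show False using e(2)[of y] by (simp add: E_def dist_commute)
    qed
    then show "x \<in> E" using x\<Omega> by (simp add: E_def)
  qed
  define F where "F n = {x \<in> K. \<forall>y\<in>\<Omega>. dist y x < 1 / real (Suc n) \<longrightarrow> norm (y - x) / real (Suc n) \<le> norm (f y - f x)}" for n
  have clF: "closed (F n)" for n
    unfolding closed_sequential_limits
  proof (intro allI impI)
    fix X l assume X: "(\<forall>k. X k \<in> F n) \<and> X \<longlonglongrightarrow> l"
    then have Xl: "X \<longlonglongrightarrow> l" by blast
    have "closed K" unfolding K_def by simp
    then have l: "l \<in> K"
      using X closed_sequentially[of K X l] by (auto simp: F_def)
    then have "l \<in> \<Omega>" using KE by (auto simp: E_def)
    then have "isCont f l" using der has_derivative_continuous by blast
    then have fX: "(\<lambda>k. f (X k)) \<longlonglongrightarrow> f l" using Xl isCont_tendsto_compose by blast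
    have "norm (y - l) / real (Suc n) \<le> norm (f y - f l)" if y: "y \<in> \<Omega>" "dist y l < 1 / real (Suc n)" for y
    proof (rule tendsto_le[OF sequentially_bot])
      show "(\<lambda>k. norm (f y - f (X k))) \<longlonglongrightarrow> norm (f y - f l)"
        by (intro tendsto_intros fX)
      show "(\<lambda>k. norm (y - X k) / real (Suc n)) \<longlonglongrightarrow> norm (y - l) / real (Suc n)"
        by (intro tendsto_intros Xl) auto
      have "(\<lambda>k. dist y (X k)) \<longlonglongrightarrow> dist y l"
        by (intro tendsto_intros Xl)
      then have "\<forall>\<^sub>F k in sequentially. dist y (X k) < 1 / real (Suc n)"
        using y(2) by (rule order_tendstoD)
      then show "\<forall>\<^sub>F k in sequentially. norm (y - X k) / real (Suc n) \<le> norm (f y - f (X k))"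
        by (rule eventually_mono) (use X y in \<open>auto simp: F_def\<close>)
    qed
    then show "l \<in> F n" using l by (simp add: F_def)
  qed
  have FK: "(\<Inter>n. K - F n) = {}"
  proof -
    have "\<exists>n. x \<in> F n" if "x \<in> K" for x
      using has_derivative_inj_lower_bound[OF der inj, of x] that KE by (auto simp: F_def E_def)
    then show ?thesis by blast
  qed
  have "\<exists>n. \<not> K \<subseteq> closure (K - F n)"
  proof (rule ccontr)
    assume "\<not> ?thesis"
    then have dense: "K \<subseteq> closure (K - F n)" for n by blast
    have "K \<subseteq> closure (\<Inter>(range (\<lambda>n. K - F n)))"
    proof (rule Baire)
      show "closed K" unfolding K_def by simp
      fix T assume "T \<in> range (\<lambda>n. K - F n)"
      then obtain n where T: "T = K - F n" by blast
      have "K - F n = K \<inter> - F n" by blast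
      then have "openin (top_of_set K) (K - F n)"
        using clF by (metis open_Compl openin_open_Int)
      then show "openin (top_of_set K) T \<and> K \<subseteq> closure T" using T dense by blast
    qed auto
    moreover have "a \<in> K"
      unfolding K_def using aE r closure_subset by fastforce
    ultimately show False unfolding FK by simp
  qed
  then obtain n x where x: "x \<in> K" "x \<notin> closure (K - F n)" by blast
  then obtain e where e: "e > 0" "\<And>y. y \<in> K - F n \<Longrightarrow> e \<le> dist y x"
    unfolding closure_approachable by (metis not_le)
  \<comment> \<open>The point \<open>x\<close> may lie on the boundary of \<open>ball a r\<close>;
    moving to a point of \<open>E\<close> inside makes \<open>E\<close> and \<open>K\<close>
    coincide nearby.\<close>
  obtain p where p: "p \<in> E" "p \<in> ball a r" "dist p x < e"
    using x(1) e(1) unfolding K_def closure_approachable by blast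
  define c where "c = 1 / real (Suc n)"
  have c: "c > 0" by (simp add: c_def)
  have "open (ball a r \<inter> ball x e)" "p \<in> ball a r \<inter> ball x e"
    using p by (auto simp: dist_commute)
  then obtain e1 where e1: "e1 > 0" "ball p e1 \<subseteq> ball a r \<inter> ball x e"
    using open_contains_ball by metis
  \<comment> \<open>The bound \<open>c / 4\<close> makes any two points of \<open>B\<close> closer
    than \<open>c\<close>, the radius in the definition of \<open>F n\<close>.\<close>
  define R where "R = min (e1 / 2) (c / 4)"
  have R: "R > 0" "R < e1" "2 * R < c" using e1 c by (auto simp: R_def)
  define B where "B = cball p R"
  have Bsub: "B \<subseteq> ball a r \<inter> ball x e" using e1 R by (auto simp: B_def)
  then have B\<Omega>: "B \<subseteq> \<Omega>" using r by (meson Int_subset_iff ball_subset_cball subset_trans)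
  have EBK: "E \<inter> B = K \<inter> B"
    using KE Bsub closure_subset[of "E \<inter> ball a r"] by (auto simp: K_def)
  have lower: "c * norm (v - z) \<le> norm (f v - f z)" if "z \<in> E \<inter> B" "v \<in> B" for z v
  proof -
    have "z \<in> K" using that EBK by blast
    moreover have "dist z x < e" using that Bsub by (auto simp: dist_commute)
    ultimately have "z \<in> F n" using e(2)[of z] by force
    moreover have "dist v z < c"
      using that R dist_triangle[of v z p] by (auto simp: B_def dist_commute)
    ultimately show ?thesis
      using that B\<Omega> by (auto simp: F_def c_def)
  qed
  have pB: "p \<in> E \<inter> B" using p R by (auto simp: B_def)
  have contB: "continuous_on B f" using cont B\<Omega> continuous_on_subset by blast
  have "p \<in> \<Omega>" using p(1) by (simp add: E_def)
  then have "isCont f p" using der has_derivative_continuous by blast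
  \<comment> \<open>On the boundary of \<open>B\<close> the values of \<open>f\<close> are at least
    \<open>c * R\<close> away from \<open>f p\<close>. So values attained within \<open>d\<close> of
    \<open>p\<close> have all their preimages in \<open>B\<close> in the interior.\<close>
  then obtain d where d: "d > 0" "\<And>w. dist w p < d \<Longrightarrow> dist (f w) (f p) < c * R"
    using c R unfolding continuous_at_eps_delta by (metis mult_pos_pos)
  \<comment> \<open>The halves leave room for the ball around \<open>w\<close> that reaches its
    nearest point of \<open>E\<close>; that ball stays within \<open>2 * \<rho>\<close> of
    \<open>p\<close>.\<close>
  define \<rho> where "\<rho> = min (d / 2) (R / 2)"
  have \<rho>: "\<rho> > 0" "2 * \<rho> \<le> d" "2 * \<rho> \<le> R" using d R by (auto simp: \<rho>_def)
  have unique: "v = w" if w: "w \<in> ball p \<rho>" and v: "v \<in> B" "f v = f w" for v w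
  proof (cases "w \<in> E")
    case True
    then have "w \<in> E \<inter> B" using w \<rho> R by (auto simp: B_def)
    then show ?thesis using lower[of w v] v c
      by (simp add: mult_le_0_iff)
  next
    case False
    have "closed (E \<inter> B)"
      unfolding EBK by (simp add: K_def B_def closed_Int)
    then obtain z where z: "z \<in> E \<inter> B" "\<And>y. y \<in> E \<inter> B \<Longrightarrow> dist w z \<le> dist w y"
      using distance_attains_inf[of "E \<inter> B" w] pB by blast
    have wz: "w \<noteq> z" using False z by blast
    have "dist w z < \<rho>"
      using z(2)[OF pB] w by (simp add: dist_commute)
    have Dsub: "ball w (dist w z) \<subseteq> ball p (2 * \<rho>)"
    proof
      fix t assume "t \<in> ball w (dist w z)"
      then show "t \<in> ball p (2 * \<rho>)"
        using \<open>dist w z < \<rho>\<close> w dist_triangle[of p t w] by simp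
    qed
    then have DB: "ball w (dist w z) \<subseteq> B" using \<rho> by (auto simp: B_def)
    have DE: "u \<notin> E" if "u \<in> ball w (dist w z)" for u
      using z(2)[of u] that DB by force
    have linjD: "locally_inj_at f u" if "u \<in> ball w (dist w z)" for u
      using DE[OF that] DB B\<Omega> that by (auto simp: E_def)
    have "z \<in> \<Omega>" using z by (simp add: E_def)
    then obtain u0 where u0: "u0 \<in> ball w (dist w z)" "\<forall>v\<in>B. f v = f u0 \<longrightarrow> v = u0"
      using unique_preimage_near_tangent_point[OF der[OF \<open>z \<in> \<Omega>\<close>] inj[OF \<open>z \<in> \<Omega>\<close>] c lower[OF z(1)] wz
          continuous_on_subset[OF contB DB] linjD] by blast
    have pre: "v' \<in> interior B \<and> locally_inj_at f v'"
      if u: "u \<in> ball w (dist w z)" and v': "v' \<in> B" "f v' = f u" for u v'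
    proof
      have "dist (f u) (f p) < c * R"
        using u Dsub \<rho> d(2)[of u] by (auto simp: dist_commute subset_iff)
      then have "c * norm (v' - p) < c * R"
        using lower[OF pB v'(1)] v'(2) by (simp add: dist_norm)
      then show "v' \<in> interior B"
        using c by (simp add: B_def dist_norm norm_minus_commute)
      \<comment> \<open>At a point of \<open>E\<close> the lower bound makes \<open>f\<close> take
        its value only once in \<open>B\<close>, which would force \<open>u = v'\<close>.\<close>
      have "v' \<notin> E"
      proof
        assume "v' \<in> E"
        then have "c * norm (u - v') \<le> norm (f u - f v')"
          using lower[of v' u] u v' DB by blast
        then have "u = v'" using c v'(2) by (simp add: mult_le_0_iff)
        then show False using DE[OF u] \<open>v' \<in> E\<close> by blast
      qed
      then show "locally_inj_at f v'" using v'(1) B\<Omega> by (auto simp: E_def)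
    qed
    have "compact B" by (simp add: B_def)
    then show ?thesis
      by (rule unique_preimage_propagates[OF _ contB open_ball connected_ball DB linjD pre u0(1) _ _ v])
         (use u0 wz in auto)
  qed
  have "ball p \<rho> \<subseteq> B" using \<rho> by (auto simp: B_def)
  then have "inj_on f (ball p \<rho>)"
    using unique by (auto simp: inj_on_def)
  then have "locally_inj_at f p"
    using \<rho> unfolding locally_inj_at_def by blast
  then show False using p(1) by (simp add: E_def)
qed

section \<open>The sign of the Jacobian\<close>

text \<open>On a small sphere the remainder is at most half the lower bound of the linear part, so
  the straight homotopy to \<open>L\<close> has no zero.\<close>

lemma vdeg_small_sphere:
  fixes f :: "real ^ 'n \<Rightarrow> real ^ 'n::finite"
  assumes der: "(f has_derivative L) (at x)" and det: "det (matrix L) \<noteq> 0"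
    and cont: "continuous_on S f" "open S" "x \<in> S"
  shows "\<exists>e>0. \<forall>s. 0 < s \<and> s < e \<longrightarrow> vdeg (\<lambda>u. f (x + s *\<^sub>R u) - f x) = vdeg L"
proof -
  have lin: "linear L"
    using der has_derivative_linear by blast
  then obtain B where B: "B > 0" "\<And>z. B * norm z \<le> norm (L z)"
    using linear_inj_bounded_below_pos matrix_nonzero_imp_inj[OF lin det] by blast
  obtain d where d: "d > 0" "\<And>y. norm (y - x) < d \<Longrightarrow> norm (f y - f x - L (y - x)) \<le> B / 2 * norm (y - x)"
    using der B(1) unfolding has_derivative_at_alt by (metis half_gt_zero)
  obtain e where e: "e > 0" "ball x e \<subseteq> S"
    using cont open_contains_ball by metis
  have "vdeg (\<lambda>u. f (x + s *\<^sub>R u) - f x) = vdeg L" if s: "0 < s" "s < min d e" for s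
  proof (rule vdeg_homotopy_linear)
    have "x + s *\<^sub>R u \<in> S" if "norm u = 1" for u
      using e s that by (intro subsetD[OF e(2)]) (simp add: dist_norm)
    then show "continuous_on (sphere 0 1) (\<lambda>u. f (x + s *\<^sub>R u) - f x)"
      by (intro continuous_intros continuous_on_compose2[OF cont(1)]) auto
    show "continuous_on (sphere 0 1) L"
      using lin by (rule linear_imp_continuous_on)
    fix t :: real and u :: "real ^ 'n"
    assume t: "0 \<le> t" "t \<le> 1" and u: "norm u = 1"
    define g where "g = f (x + s *\<^sub>R u) - f x"
    have g: "norm (g - s *\<^sub>R L u) \<le> B / 2 * s"
      using d(2)[of "x + s *\<^sub>R u"] s u by (simp add: g_def linear_cmul[OF lin])
    show "(1 - t) *\<^sub>R (f (x + s *\<^sub>R u) - f x) + t *\<^sub>R L u \<noteq> 0"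
    proof
      assume "(1 - t) *\<^sub>R (f (x + s *\<^sub>R u) - f x) + t *\<^sub>R L u = 0"
      \<comment> \<open>The segment joins a vector near \<open>s *\<^sub>R L u\<close> to the
        unscaled \<open>L u\<close>; a zero would make a multiple of \<open>L u\<close> as small as
        the remainder.\<close>
      then have "(1 - t) *\<^sub>R (g - s *\<^sub>R L u) = - (((1 - t) * s + t) *\<^sub>R L u)"
        by (simp add: g_def algebra_simps eq_neg_iff_add_eq_0)
      then have "norm ((1 - t) *\<^sub>R (g - s *\<^sub>R L u)) = norm (((1 - t) * s + t) *\<^sub>R L u)"
        by simp
      moreover have "0 \<le> (1 - t) * s + t"
        using s t by simp
      ultimately have "(1 - t) * norm (g - s *\<^sub>R L u) = ((1 - t) * s + t) * norm (L u)"
        using t by simp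
      moreover have "((1 - t) * s + t) * B \<le> ((1 - t) * s + t) * norm (L u)"
        using B(2)[of u] u \<open>0 \<le> (1 - t) * s + t\<close> by (intro mult_left_mono) auto
      moreover have "(1 - t) * norm (g - s *\<^sub>R L u) \<le> (1 - t) * (B / 2 * s)"
        using g t by (intro mult_left_mono) auto
      ultimately have "((1 - t) * s + t) * B \<le> (1 - t) * (B / 2 * s)"
        by linarith
      moreover have "((1 - t) * s / 2 + t) * B = ((1 - t) * s + t) * B - (1 - t) * (B / 2 * s)"
        by (simp add: field_simps)
      ultimately have "((1 - t) * s / 2 + t) * B \<le> 0"
        by linarith
      moreover have "(1 - t) * s / 2 + t > 0"
        using s t by (cases "t = 1") (auto intro!: add_pos_nonneg)
      ultimately show False
        using B(1) by (simp add: mult_le_0_iff)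
    qed
  qed
  then show ?thesis
    using d e by (intro exI[of _ "min d e"]) auto
qed

text \<open>By injectivity a difference of values at distinct points never vanishes, so the centre
  of a sphere of fixed radius can slide from \<open>x\<close> to \<open>y\<close> without changing
  the degree.\<close>

lemma inj_on_ball_imp_sgn_det_eq:
  fixes f :: "real ^ 'n \<Rightarrow> real ^ 'n::finite"
  assumes inj: "inj_on f (ball a r)" and cont: "continuous_on (ball a r) f"
    and x: "x \<in> ball a r" "(f has_derivative L) (at x)" "det (matrix L) \<noteq> 0"
    and y: "y \<in> ball a r" "(f has_derivative L') (at y)" "det (matrix L') \<noteq> 0"
  shows "sgn (det (matrix L)) = sgn (det (matrix L'))"
proof -
  obtain e where e: "e > 0" "\<And>s. 0 < s \<Longrightarrow> s < e \<Longrightarrow> vdeg (\<lambda>u. f (x + s *\<^sub>R u) - f x) = vdeg L"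
    using vdeg_small_sphere[OF x(2,3) cont open_ball x(1)] by blast
  obtain e' where e': "e' > 0" "\<And>s. 0 < s \<Longrightarrow> s < e' \<Longrightarrow> vdeg (\<lambda>u. f (y + s *\<^sub>R u) - f y) = vdeg L'"
    using vdeg_small_sphere[OF y(2,3) cont open_ball y(1)] by blast
  \<comment> \<open>By convexity the whole segment stays within \<open>m\<close> of
    \<open>a\<close>, so one radius below \<open>r - m\<close> suits every centre.\<close>
  define m where "m = max (dist a x) (dist a y)"
  have m: "m < r" using x y by (simp add: m_def)
  define s where "s = min (min e e') (r - m) / 2"
  have s: "0 < s" "s < e" "s < e'" "s < r - m"
    using e e' m by (auto simp: s_def)
  define p where "p t = x + t *\<^sub>R (y - x)" for t
  have p_m: "dist a (p t) \<le> m" if "0 \<le> t" "t \<le> 1" for t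
  proof -
    have "(1 - t) *\<^sub>R x + t *\<^sub>R y \<in> cball a m"
      by (rule convexD_alt[OF convex_cball]) (use that in \<open>auto simp: m_def\<close>)
    moreover have "(1 - t) *\<^sub>R x + t *\<^sub>R y = p t"
      by (simp add: p_def algebra_simps)
    ultimately show ?thesis by simp
  qed
  have in_ball: "p t \<in> ball a r" "p t + s *\<^sub>R u \<in> ball a r"
    if "0 \<le> t" "t \<le> 1" "norm u = 1" for t u
  proof -
    show "p t \<in> ball a r" using p_m[OF that(1,2)] m by simp
    have "dist (p t) (p t + s *\<^sub>R u) = s" using that s by (simp add: dist_norm)
    then show "p t + s *\<^sub>R u \<in> ball a r"
      using p_m[OF that(1,2)] s dist_triangle[of a "p t + s *\<^sub>R u" "p t"] by simp
  qed
  have "vdeg (\<lambda>u. f (p 0 + s *\<^sub>R u) - f (p 0)) = vdeg (\<lambda>u. f (p 1 + s *\<^sub>R u) - f (p 1))"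
  proof (rule vdeg_homotopy[of "\<lambda>t u. f (p t + s *\<^sub>R u) - f (p t)"])
    have "continuous_on ({0..1} \<times> sphere 0 1) (\<lambda>z. f (p (fst z) + s *\<^sub>R snd z) - f (p (fst z)))"
    proof (intro continuous_on_diff continuous_on_compose2[OF cont])
      show "continuous_on ({0..1} \<times> sphere 0 1) (\<lambda>z. p (fst z) + s *\<^sub>R snd z)"
        "continuous_on ({0..1} \<times> sphere 0 1) (\<lambda>z. p (fst z))"
        unfolding p_def by (intro continuous_intros)+
      show "(\<lambda>z. p (fst z) + s *\<^sub>R snd z) ` ({0..1} \<times> sphere 0 1) \<subseteq> ball a r"
        "(\<lambda>z. p (fst z)) ` ({0..1} \<times> sphere 0 (1::real) :: (real \<times> (real ^ 'n)) set) \<subseteq> ball a r"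
        using in_ball by (auto simp del: mem_ball)
    qed
    then show "continuous_on ({0..1} \<times> sphere 0 1) (\<lambda>(t, u). f (p t + s *\<^sub>R u) - f (p t))"
      by (simp add: case_prod_beta)
    fix t :: real and u :: "real ^ 'n"
    assume t: "0 \<le> t" "t \<le> 1" and u: "norm u = 1"
    have "p t + s *\<^sub>R u \<noteq> p t" using s u by auto
    then show "f (p t + s *\<^sub>R u) - f (p t) \<noteq> 0"
      using in_ball[OF t u] inj by (auto dest: inj_onD)
  qed
  then have "vdeg L = vdeg L'"
    using e(2)[OF s(1,2)] e'(2)[OF s(1,3)] by (simp add: p_def)
  then show ?thesis
    using vdeg_linear[OF has_derivative_linear[OF x(2)] x(3)] vdeg_linear[OF has_derivative_linear[OF y(2)] y(3)]
    by simp
qed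

theorem sgn_det_locally_constant:
  fixes f :: "real ^ 'n \<Rightarrow> real ^ 'n::finite"
  assumes Om: "open \<Omega>" and der: "\<And>x. x \<in> \<Omega> \<Longrightarrow> (f has_derivative f' x) (at x)"
    and det: "\<And>x. x \<in> \<Omega> \<Longrightarrow> det (matrix (f' x)) \<noteq> 0" and a: "a \<in> \<Omega>"
  shows "\<exists>e>0. ball a e \<subseteq> \<Omega> \<and> (\<forall>x\<in>ball a e. sgn (det (matrix (f' x))) = sgn (det (matrix (f' a))))"
proof -
  have "inj (f' x)" if "x \<in> \<Omega>" for x
    using matrix_nonzero_imp_inj[OF has_derivative_linear[OF der] det] that by blast
  then have "locally_inj_at f a"
    using differentiable_invertible_imp_locally_inj[of \<Omega> f f' a] Om der a by blast
  then obtain e where e: "e > 0" "ball a e \<subseteq> \<Omega>" "inj_on f (ball a e)"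
    by (rule locally_inj_atE[OF _ Om a])
  have cont: "continuous_on (ball a e) f"
    using der e(2) by (meson continuous_at_imp_continuous_on has_derivative_continuous subsetD)
  have "sgn (det (matrix (f' x))) = sgn (det (matrix (f' a)))" if x: "x \<in> ball a e" for x
  proof -
    have "x \<in> \<Omega>" "a \<in> ball a e"
      using x e(1,2) by (blast, simp)
    then show ?thesis
      using inj_on_ball_imp_sgn_det_eq[OF e(3) cont x der det _ der[OF a] det[OF a]] by blast
  qed
  then show ?thesis using e by blast
qed

section \<open>Passage from charts to the manifold\<close>

lemma positive_charts_atI:
  assumes "oriented_C1_manifold X A" "c \<in> A" "x \<in> fst c"
  shows "c \<in> positive_charts_at X A x"
  using assms unfolding oriented_C1_manifold_def C1_manifold_def positive_charts_at_def by blast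

lemma chart_coord_preimage_openin:
  assumes c: "local_chart X c" and V: "open V"
  shows "openin X {y \<in> fst c. snd c y \<in> V}"
proof -
  have o: "openin X (fst c)" and h: "continuous_map (subtopology X (fst c)) (top_of_set (snd c ` fst c)) (snd c)"
    using c homeomorphic_imp_continuous_map unfolding local_chart_def by auto
  have "continuous_map (subtopology X (fst c)) euclidean (snd c)"
    using h by (simp add: continuous_map_in_subtopology)
  then have "openin (subtopology X (fst c)) {y \<in> topspace (subtopology X (fst c)). snd c y \<in> V}"
    by (rule openin_continuous_map_preimage) (use V in simp)
  moreover have "topspace (subtopology X (fst c)) = fst c"
    using o openin_subset by fastforce
  ultimately show ?thesis
    using o openin_trans_full by metis
qed

text \<open>One pair of atlas charts serves at all points near \<open>x\<close>. The Euclidean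
  result applies there, and independence of the sign from the charts transfers it to every other
  pair.\<close>

lemma chart_det_sgn_locally_const_near:
  assumes M: "oriented_C1_manifold X A" and N: "oriented_C1_manifold Y B"
    and diff: "manifold_differentiable X A Y B f"
    and nc: "\<And>x. \<not> critical_point X A Y B f x"
    and x: "x \<in> topspace X" and c: "c \<in> positive_charts_at X A x" and d: "d \<in> positive_charts_at Y B (f x)"
  shows "\<exists>W. openin X W \<and> x \<in> W \<and> (\<forall>y\<in>W. \<forall>c'\<in>positive_charts_at X A y. \<forall>d'\<in>positive_charts_at Y B (f y).
           sgn (chart_det f c' d' y) = sgn (chart_det f c d x))"
proof -
  have cont: "topcontinuous_at X Y f y" if "y \<in> topspace X" for y
    using diff that unfolding manifold_differentiable_def manifold_differentiable_at_def by blast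
  have all_diff: "chart_rep f c d differentiable (at (snd c y))"
    if y: "y \<in> topspace X" "c \<in> positive_charts_at X A y" "d \<in> positive_charts_at Y B (f y)" for y c d
  proof -
    obtain c' d' where "c' \<in> positive_charts_at X A y" "d' \<in> positive_charts_at Y B (f y)"
        "chart_rep f c' d' differentiable (at (snd c' y))"
      using diff y(1) unfolding manifold_differentiable_def manifold_differentiable_at_def by blast
    then show ?thesis
      using sgn_chart_det_independent(1)[OF M N cont[OF y(1)]] y by blast
  qed
  have indep: "sgn (chart_det f c' d' y) = sgn (chart_det f c d y)"
    if "y \<in> topspace X" "c \<in> positive_charts_at X A y" "c' \<in> positive_charts_at X A y"
      "d \<in> positive_charts_at Y B (f y)" "d' \<in> positive_charts_at Y B (f y)" for y c c' d d'
    using sgn_chart_det_independent(2)[OF M N cont[OF that(1)] that(2-5) all_diff] that by blast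
  \<comment> \<open>A critical point requires a zero in all pairs of charts; by independence of the
    sign, one zero already gives this.\<close>
  have nz: "chart_det f c d y \<noteq> 0"
    if y: "y \<in> topspace X" "c \<in> positive_charts_at X A y" "d \<in> positive_charts_at Y B (f y)" for y c d
  proof
    assume "chart_det f c d y = 0"
    then have "critical_point X A Y B f y"
      unfolding critical_point_def using y indep[OF y(1,2) _ y(3)] by (metis sgn_0_0 sgn_zero_iff)
    then show False using nc by blast
  qed
  obtain a where a: "a \<in> A" "a \<in> positive_charts_at X A x"
    using positive_charts_at_nonempty[OF M x] by blast
  have "f x \<in> topspace Y"
    using cont[OF x] by (auto simp: topcontinuous_at_def)
  then obtain b where b: "b \<in> B" "b \<in> positive_charts_at Y B (f x)"
    using positive_charts_at_nonempty[OF N] by blast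
  have ab: "local_chart X a" "x \<in> fst a" "local_chart Y b" "f x \<in> fst b"
    using a b by (auto simp: positive_charts_at_def)
  then have "openin Y (fst b)" by (simp add: local_chart_def)
  \<comment> \<open>Continuity keeps \<open>f y\<close> in the domain of \<open>b\<close>, so that
    the representation in \<open>a\<close> and \<open>b\<close> is meaningful near
    \<open>x\<close>.\<close>
  then obtain U where U: "openin X U" "x \<in> U" "\<And>y. y \<in> U \<Longrightarrow> f y \<in> fst b"
    using cont[OF x] ab unfolding topcontinuous_at_def by (elim conjE) metis
  have UX: "U \<subseteq> topspace X" using U(1) by (rule openin_subset)
  define g where "g = chart_rep f a b"
  define \<Omega> where "\<Omega> = snd a ` (fst a \<inter> U)"
  have "open \<Omega>"
    unfolding \<Omega>_def by (rule open_chart_image[OF ab(1) U(1)])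
  have charts: "a \<in> positive_charts_at X A y" "b \<in> positive_charts_at Y B (f y)" if "y \<in> fst a \<inter> U" for y
    using that U(3) positive_charts_atI[OF M a(1)] positive_charts_atI[OF N b(1)] by auto
  have der: "(g has_derivative frechet_derivative g (at u)) (at u)" if u: "u \<in> \<Omega>" for u
  proof -
    obtain y where y: "y \<in> fst a \<inter> U" "u = snd a y" using u by (auto simp: \<Omega>_def)
    then show ?thesis
      using all_diff[OF _ charts[OF y(1)]] UX unfolding g_def by (auto simp flip: frechet_derivative_works)
  qed
  have det_y: "det (matrix (frechet_derivative g (at (snd a y)))) = chart_det f a b y" for y
    by (simp add: chart_det_def jacobian_def g_def)
  have det: "det (matrix (frechet_derivative g (at u))) \<noteq> 0" if u: "u \<in> \<Omega>" for u
  proof -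
    obtain y where y: "y \<in> fst a \<inter> U" "u = snd a y" using u by (auto simp: \<Omega>_def)
    then show ?thesis
      using nz[OF _ charts[OF y(1)]] UX det_y by auto
  qed
  have "snd a x \<in> \<Omega>" using ab U by (auto simp: \<Omega>_def)
  then obtain e where e: "e > 0" "\<And>u. u \<in> ball (snd a x) e \<Longrightarrow>
      sgn (det (matrix (frechet_derivative g (at u)))) = sgn (det (matrix (frechet_derivative g (at (snd a x)))))"
    using sgn_det_locally_constant[OF \<open>open \<Omega>\<close> der det] by blast
  define W where "W = U \<inter> {y \<in> fst a. snd a y \<in> ball (snd a x) e}"
  have "openin X W"
    unfolding W_def using U(1) chart_coord_preimage_openin[OF ab(1) open_ball] by blast
  moreover have "x \<in> W" using U ab e by (simp add: W_def)
  moreover have "sgn (chart_det f c' d' y) = sgn (chart_det f c d x)"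
    if y: "y \<in> W" "c' \<in> positive_charts_at X A y" "d' \<in> positive_charts_at Y B (f y)" for y c' d'
  proof -
    have yU: "y \<in> fst a \<inter> U" "y \<in> topspace X" using y UX by (auto simp: W_def)
    have "sgn (chart_det f c' d' y) = sgn (chart_det f a b y)"
      using indep[OF yU(2) charts(1)[OF yU(1)] y(2) charts(2)[OF yU(1)] y(3)] .
    also have "\<dots> = sgn (chart_det f a b x)"
      using e(2)[of "snd a y"] y by (simp add: W_def det_y)
    also have "\<dots> = sgn (chart_det f c d x)"
      using indep[OF x c a(2) d b(2)] .
    finally show ?thesis .
  qed
  ultimately show ?thesis by blast
qed

theorem corollary5p2:
  fixes M :: "'a topology" and N :: "'b topology"
    and A :: "('a, 'n::finite) chart set" and B :: "('b, 'n) chart set"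
    and f :: "'a \<Rightarrow> 'b"
  assumes "oriented_C1_manifold M A" and "connected_space M"
    and "oriented_C1_manifold N B" and "connected_space N"
    and "manifold_differentiable M A N B f"
    and "x\<^sub>0 \<in> topspace M" and "c\<^sub>0 \<in> positive_charts_at M A x\<^sub>0"
    and "d\<^sub>0 \<in> positive_charts_at N B (f x\<^sub>0)" and "chart_det f c\<^sub>0 d\<^sub>0 x\<^sub>0 < 0"
    and "x\<^sub>1 \<in> topspace M" and "c\<^sub>1 \<in> positive_charts_at M A x\<^sub>1"
    and "d\<^sub>1 \<in> positive_charts_at N B (f x\<^sub>1)" and "chart_det f c\<^sub>1 d\<^sub>1 x\<^sub>1 > 0"
  shows "\<exists>x. critical_point M A N B f x"
proof (rule ccontr)
  assume "\<not> ?thesis"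
  then have nc: "\<And>x. \<not> critical_point M A N B f x" by blast
  note loc = chart_det_sgn_locally_const_near[OF assms(1,3,5) nc]
  define S where "S \<sigma> = {x \<in> topspace M. \<exists>c\<in>positive_charts_at M A x. \<exists>d\<in>positive_charts_at N B (f x).
    sgn (chart_det f c d x) = \<sigma>}" for \<sigma>
  have charts: "\<exists>c d. c \<in> positive_charts_at M A x \<and> d \<in> positive_charts_at N B (f x)" if "x \<in> topspace M" for x
    using assms(5) that unfolding manifold_differentiable_def manifold_differentiable_at_def by blast
  have const_near: "\<exists>W. openin M W \<and> x \<in> W \<and> (\<forall>y\<in>W. \<forall>c\<in>positive_charts_at M A y.
      \<forall>d\<in>positive_charts_at N B (f y). sgn (chart_det f c d y) = \<sigma>)" if "x \<in> S \<sigma>" for x \<sigma>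
    using that loc[of x] unfolding S_def by blast
  have uniq: "sgn (chart_det f c d x) = \<sigma>" if "x \<in> S \<sigma>"
    "c \<in> positive_charts_at M A x" "d \<in> positive_charts_at N B (f x)" for x \<sigma> c d
    using const_near[OF that(1)] that(2,3) by blast
  have S_subset: "S \<sigma> \<subseteq> topspace M" for \<sigma>
    by (auto simp: S_def)
  have opS: "openin M (S \<sigma>)" for \<sigma>
  proof -
    have "\<exists>T. openin M T \<and> x \<in> T \<and> T \<subseteq> S \<sigma>" if x: "x \<in> S \<sigma>" for x
    proof -
      obtain W where W: "openin M W" "x \<in> W" "\<forall>y\<in>W. \<forall>c\<in>positive_charts_at M A y.
        \<forall>d\<in>positive_charts_at N B (f y). sgn (chart_det f c d y) = \<sigma>"
        using const_near[OF x] by blast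
      have "y \<in> S \<sigma>" if "y \<in> W" for y
        using that W(3) charts[of y] openin_subset[OF W(1)] unfolding S_def by blast
      then show ?thesis using W(1,2) by blast
    qed
    then show ?thesis using openin_subopen[of M "S \<sigma>"] by blast
  qed
  \<comment> \<open>Collecting all signs other than -1 makes the two open sets cover the manifold
    without a case distinction.\<close>
  let ?T = "\<Union>\<sigma>\<in>-{-1}. S \<sigma>"
  have opT: "openin M ?T"
    using opS by (intro openin_Union) auto
  have disj: "S (-1) \<inter> ?T = {}"
  proof -
    have "\<sigma> = \<tau>" if "x \<in> S \<sigma>" "x \<in> S \<tau>" for x \<sigma> \<tau>
      using uniq[OF that(1)] uniq[OF that(2)] charts S_subset that(1) by blast
    then show ?thesis by blast
  qed
  have cover: "topspace M \<subseteq> S (-1) \<union> ?T"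
  proof
    fix x assume "x \<in> topspace M"
    then have "\<exists>\<sigma>. x \<in> S \<sigma>"
      using charts[of x] unfolding S_def by blast
    then show "x \<in> S (-1) \<union> ?T" by blast
  qed
  have "x\<^sub>0 \<in> S (-1)" "x\<^sub>1 \<in> S 1"
    unfolding S_def using assms(6-13) sgn_neg[OF assms(9)] sgn_pos[OF assms(13)] by blast+
  moreover from this have "x\<^sub>1 \<in> ?T"
    by auto
  ultimately have "S (-1) \<noteq> {}" "?T \<noteq> {}"
    by (metis empty_iff)+
  with opS[of "-1"] opT cover disj show False
    using assms(2) unfolding connected_space_def by metis
qed

end
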